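(* Let the coefficients $p$, $q=\nu'$ and the initial data $u_0,u_1$ be distributions on $(0,1)$. Then the initial/boundary problem $\partial_t^2u-\partial_x^2u+p(x)\partial_xu+q(x)u=0$ on $[0,T]\times(0,1)$, $u(0,\cdot)=u_0$, $\partial_tu(0,\cdot)=u_1$, $u(t,0)=u(t,1)=0$, has a very weak solution.
   Context: Nets are indexed by $\varepsilon\in(0,1]$. A net $(u_\varepsilon(t,x))$ is $L^2$-moderate if there are $N\in\mathbb N_0$, $C>0$ with $\|u_\varepsilon(t,\cdot)\|_{L^2}\le C\varepsilon^{-N}$ for all $t\in[0,T]$ (for nets not depending on $t$, the same without $t$). A net $(u_{0,\varepsilon})$ is $H^2$-moderate if there are $N,C$ with $\|u_{0,\varepsilon}\|_{L^2},\|u'_{0,\varepsilon}\|_{L^2},\|u''_{0,\varepsilon}\|_{L^2}\le C\varepsilon^{-N}$. A net $(\nu_\varepsilon)$ is $L^\infty_1$-moderate if there are $N,C$ with $\|\nu_\varepsilon\|_{L^\infty}\le C\varepsilon^{-N}$ and $\|\nu_\varepsilon'\|_{L^\infty}\le C\varepsilon^{-N}$. A net $(p_\varepsilon)$ is $\log$-$L^\infty_1$-moderate if there are $N,C$ with $\|p_\varepsilon\|_{L^\infty}\le C|\log\varepsilon|^N$ and $\|p'_\varepsilon\|_{L^\infty}\le C\varepsilon^{-N}$. A net $(u_\varepsilon)$ is a very weak solution of the problem if there exist a $\log$-$L^\infty_1$-moderate regularisation $(p_\varepsilon)$ of $p$, an $L^\infty_1$-moderate regularisation $(\nu_\varepsilon)$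 of $\nu$ with $q_\varepsilon=\nu_\varepsilon'$, an $H^2$-moderate regularisation $(u_{0,\varepsilon})$ of $u_0$ and an $L^2$-moderate regularisation $(u_{1,\varepsilon})$ of $u_1$ (regularisations are nets of smooth functions, e.g. convolutions with mollifiers, converging to the given distributions) such that for each $\varepsilon$, $u_\varepsilon$ solves $\partial_t^2u_\varepsilon-\partial_x^2u_\varepsilon+p_\varepsilon\partial_xu_\varepsilon+q_\varepsilon u_\varepsilon=0$ on $[0,T]\times(0,1)$, $u_\varepsilon(0,\cdot)=u_{0,\varepsilon}$, $\partial_tu_\varepsilon(0,\cdot)=u_{1,\varepsilon}$, $u_\varepsilon(t,0)=u_\varepsilon(t,1)=0$, and both $(u_\varepsilon)$ and $(\partial_xu_\varepsilon)$ are $L^2$-moderate. *)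

theory Defs
  imports "HOL-Analysis.Analysis"
begin

text \<open>Functions of one real variable; the open interval (0,1) is the spatial domain.
 Nets are indexed by eps in (0,1]; a net is a function of eps (values outside (0,1] irrelevant).\<close>

definition smooth_everywhere :: "(real \<Rightarrow> real) \<Rightarrow> bool" where
  "smooth_everywhere f \<longleftrightarrow> (\<forall>n x. ((deriv ^^ n) f) differentiable (at x))"

definition smooth_on01 :: "(real \<Rightarrow> real) \<Rightarrow> bool" where
  "smooth_on01 f \<longleftrightarrow> (\<forall>n. \<forall>x\<in>{0<..<1}. ((deriv ^^ n) f) differentiable (at x))"

definition supported_in :: "(real \<Rightarrow> real) \<Rightarrow> real \<Rightarrow> real \<Rightarrow> bool" where
  "supported_in \<phi> a b \<longleftrightarrow> (\<forall>x. x \<notin> {a..b} \<longrightarrow> \<phi> x = 0)"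

definition test_fun01 :: "(real \<Rightarrow> real) \<Rightarrow> bool" where
  "test_fun01 \<phi> \<longleftrightarrow> smooth_everywhere \<phi> \<and>
     (\<exists>a b. 0 < a \<and> a \<le> b \<and> b < 1 \<and> supported_in \<phi> a b)"

definition distribution01 :: "((real \<Rightarrow> real) \<Rightarrow> real) \<Rightarrow> bool" where
  "distribution01 U \<longleftrightarrow>
     (\<forall>\<phi> \<psi> c d. test_fun01 \<phi> \<longrightarrow> test_fun01 \<psi> \<longrightarrow>
        U (\<lambda>x. c * \<phi> x + d * \<psi> x) = c * U \<phi> + d * U \<psi>) \<and>
     (\<forall>a b. 0 < a \<longrightarrow> a \<le> b \<longrightarrow> b < 1 \<longrightarrow>
        (\<exists>C k. \<forall>\<phi>. test_fun01 \<phi> \<longrightarrow> supported_in \<phi> a b \<longrightarrow>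
           \<bar>U \<phi>\<bar> \<le> C * (\<Sum>j\<le>(k::nat). (SUP x. \<bar>(deriv ^^ j) \<phi> x\<bar>))))"

definition regularises :: "(real \<Rightarrow> real \<Rightarrow> real) \<Rightarrow> ((real \<Rightarrow> real) \<Rightarrow> real) \<Rightarrow> bool" where
  "regularises f U \<longleftrightarrow>
     (\<forall>\<epsilon>\<in>{0<..1}. smooth_on01 (f \<epsilon>)) \<and>
     (\<forall>\<phi>. test_fun01 \<phi> \<longrightarrow>
        ((\<lambda>\<epsilon>. (LBINT x=0..1. f \<epsilon> x * \<phi> x)) \<longlongrightarrow> U \<phi>) (at_right 0))"

definition L2_01 :: "(real \<Rightarrow> real) \<Rightarrow> bool" where
  "L2_01 f \<longleftrightarrow> f \<in> borel_measurable (restrict_space lborel {0<..<1}) \<and>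
     interval_lebesgue_integrable lborel 0 1 (\<lambda>x. (f x)^2)"

definition L2norm01 :: "(real \<Rightarrow> real) \<Rightarrow> real" where
  "L2norm01 f = sqrt (LBINT x=0..1. (f x)^2)"

definition L2_bounded :: "(real \<Rightarrow> real) \<Rightarrow> real \<Rightarrow> bool" where
  "L2_bounded f M \<longleftrightarrow> L2_01 f \<and> L2norm01 f \<le> M"

definition Linf_bounded :: "(real \<Rightarrow> real) \<Rightarrow> real \<Rightarrow> bool" where
  "Linf_bounded f M \<longleftrightarrow> (\<forall>x\<in>{0<..<1}. \<bar>f x\<bar> \<le> M)"

definition L2_moderate :: "(real \<Rightarrow> real \<Rightarrow> real) \<Rightarrow> bool" where
  "L2_moderate f \<longleftrightarrow> (\<exists>(N::nat) C. C > 0 \<and>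
     (\<forall>\<epsilon>\<in>{0<..1}. L2_bounded (f \<epsilon>) (C / \<epsilon> ^ N)))"

definition L2_moderate_t :: "real \<Rightarrow> (real \<Rightarrow> real \<Rightarrow> real \<Rightarrow> real) \<Rightarrow> bool" where
  "L2_moderate_t T u \<longleftrightarrow> (\<exists>(N::nat) C. C > 0 \<and>
     (\<forall>\<epsilon>\<in>{0<..1}. \<forall>t\<in>{0..T}. L2_bounded (u \<epsilon> t) (C / \<epsilon> ^ N)))"

definition H2_moderate :: "(real \<Rightarrow> real \<Rightarrow> real) \<Rightarrow> bool" where
  "H2_moderate f \<longleftrightarrow> (\<exists>(N::nat) C. C > 0 \<and>
     (\<forall>\<epsilon>\<in>{0<..1}. L2_bounded (f \<epsilon>) (C / \<epsilon> ^ N) \<and>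
        L2_bounded (deriv (f \<epsilon>)) (C / \<epsilon> ^ N) \<and>
        L2_bounded (deriv (deriv (f \<epsilon>))) (C / \<epsilon> ^ N)))"

definition Linf1_moderate :: "(real \<Rightarrow> real \<Rightarrow> real) \<Rightarrow> bool" where
  "Linf1_moderate f \<longleftrightarrow> (\<exists>(N::nat) C. C > 0 \<and>
     (\<forall>\<epsilon>\<in>{0<..1}. Linf_bounded (f \<epsilon>) (C / \<epsilon> ^ N) \<and>
        Linf_bounded (deriv (f \<epsilon>)) (C / \<epsilon> ^ N)))"

definition log_Linf1_moderate :: "(real \<Rightarrow> real \<Rightarrow> real) \<Rightarrow> bool" where
  "log_Linf1_moderate f \<longleftrightarrow> (\<exists>(N::nat) C. C > 0 \<and>
     (\<forall>\<epsilon>\<in>{0<..1}. Linf_bounded (f \<epsilon>) (C * \<bar>ln \<epsilon>\<bar> ^ N) \<and>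
        Linf_bounded (deriv (f \<epsilon>)) (C / \<epsilon> ^ N)))"

definition solves_wave ::
  "real \<Rightarrow> (real \<Rightarrow> real) \<Rightarrow> (real \<Rightarrow> real) \<Rightarrow> (real \<Rightarrow> real) \<Rightarrow> (real \<Rightarrow> real)
     \<Rightarrow> (real \<Rightarrow> real \<Rightarrow> real) \<Rightarrow> bool" where
  "solves_wave T p q u0 u1 u \<longleftrightarrow>
     (\<exists>ut utt ux uxx :: real \<Rightarrow> real \<Rightarrow> real.
        (\<forall>t\<in>{0..T}. \<forall>x\<in>{0<..<1}.
           ((\<lambda>s. u s x) has_real_derivative ut t x) (at t within {0..T}) \<and>
           ((\<lambda>s. ut s x) has_real_derivative utt t x) (at t within {0..T}) \<and>
           ((\<lambda>y. u t y) has_real_derivative ux t x) (at x) \<and>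
           ((\<lambda>y. ux t y) has_real_derivative uxx t x) (at x) \<and>
           utt t x - uxx t x + p x * ux t x + q x * u t x = 0) \<and>
        (\<forall>x\<in>{0<..<1}. u 0 x = u0 x \<and> ut 0 x = u1 x)) \<and>
     (\<forall>t\<in>{0..T}. continuous_on {0..1} (\<lambda>y. u t y) \<and> u t 0 = 0 \<and> u t 1 = 0)"

text \<open>Very weak solution; the zero-order coefficient is q = nu', regularised as q_eps = nu_eps'.\<close>
definition very_weak_solution ::
  "real \<Rightarrow> ((real \<Rightarrow> real) \<Rightarrow> real) \<Rightarrow> ((real \<Rightarrow> real) \<Rightarrow> real) \<Rightarrow>
   ((real \<Rightarrow> real) \<Rightarrow> real) \<Rightarrow> ((real \<Rightarrow> real) \<Rightarrow> real) \<Rightarrow>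
   (real \<Rightarrow> real \<Rightarrow> real \<Rightarrow> real) \<Rightarrow> bool" where
  "very_weak_solution T p \<nu> u0 u1 u \<longleftrightarrow>
     (\<exists>p\<^sub>\<epsilon> \<nu>\<^sub>\<epsilon> u0\<^sub>\<epsilon> u1\<^sub>\<epsilon>.
        log_Linf1_moderate p\<^sub>\<epsilon> \<and> regularises p\<^sub>\<epsilon> p \<and>
        Linf1_moderate \<nu>\<^sub>\<epsilon> \<and> regularises \<nu>\<^sub>\<epsilon> \<nu> \<and>
        H2_moderate u0\<^sub>\<epsilon> \<and> regularises u0\<^sub>\<epsilon> u0 \<and>
        L2_moderate u1\<^sub>\<epsilon> \<and> regularises u1\<^sub>\<epsilon> u1 \<and>
        (\<forall>\<epsilon>\<in>{0<..1}. solves_wave T (p\<^sub>\<epsilon> \<epsilon>) (deriv (\<nu>\<^sub>\<epsilon> \<epsilon>))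
                          (u0\<^sub>\<epsilon> \<epsilon>) (u1\<^sub>\<epsilon> \<epsilon>) (u \<epsilon>)) \<and>
        L2_moderate_t T u \<and>
        L2_moderate_t T (\<lambda>\<epsilon> t. deriv (u \<epsilon> t)))"

end

theory Submission
  imports Defs
begin

text \<open>
  Regularising nets may be reindexed freely, so it suffices to approximate every distribution by a
  sequence of finite sine sums and to let the index grow slowly as epsilon tends to 0: every finite
  quantity attached to the n-th approximation, including norms of the solution, is then dominated
  by the logarithm of epsilon, and no energy estimate is needed.

  Sine sums are dense among distributions: a mollified distribution divided by sin (pi x) is
  approximated by polynomials in cos (pi x). For coefficients and data that are sine sums,
  the wave equation respects odd 2-periodic reflection, which absorbs the boundary conditions, and
  its power series in time converges for all times.
\<close>

subsection \<open>Finite sine sums\<close>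

text \<open>The obstacle is convergence in time. In
  \<open>v (n+2) = v n'' - (p * v n' + q * v n)\<close> the frequency may grow linearly in n, so a
  crude bound on \<open>v n\<close> is comparable with n! times a power, which gives only a finite
  radius of convergence. Counting the number j of lower-order applications repairs this: the
  frequency is a0 + j*d, and such an application uses two time steps but costs at most one space
  derivative. After division by n! the growth in j is a geometric factor against 1/j!.

  Parity dictates the class of coefficients. For odd p and odd \<nu> the coefficient q = \<nu>' is
  even, so p * u_x and q * u are odd whenever u is; the second space derivative is odd too, and the
  coefficients stay in one class.

  A distribution on (0,1) gives no control at the endpoints, and sin (pi x) vanishes there. Both
  difficulties are met by evaluating the mollified distribution, and the sine it is divided by, at x
  clamped to [2 \<delta>, 1 - 2 \<delta>]; test functions supported inside that interval do not see
  the change.\<close>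

text \<open>The function f is a finite sum of terms c sin (k pi x) with frequencies at most a and coefficients
  of total size at most M. Such functions are odd and 2-periodic, so they satisfy the boundary conditions.\<close>
inductive sinp :: "real \<Rightarrow> real \<Rightarrow> (real \<Rightarrow> real) \<Rightarrow> bool" for a where
  basis: "\<bar>of_int k * pi\<bar> \<le> a \<Longrightarrow> \<bar>c\<bar> \<le> M \<Longrightarrow> sinp a M (\<lambda>x. c * sin (of_int k * pi * x))"
| add: "sinp a M f \<Longrightarrow> sinp a N g \<Longrightarrow> sinp a (M + N) (\<lambda>x. f x + g x)"

lemma sinp_nonneg: "sinp a M f \<Longrightarrow> 0 \<le> a \<and> 0 \<le> M"
  by (induction rule: sinp.induct) auto

lemma sinp_mono: "sinp a M f \<Longrightarrow> a \<le> b \<Longrightarrow> M \<le> N \<Longrightarrow> sinp b N f"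
proof (induction arbitrary: N rule: sinp.induct)
  case (basis k c M)
  then show ?case by (intro sinp.basis) auto
next
  case (add M f N' g)
  \<comment> \<open>The whole slack is given to the second summand, whose induction hypothesis
    allows any larger bound.\<close>
  have "sinp b (M + (N - M)) (\<lambda>x. f x + g x)"
    using add by (intro sinp.add) auto
  then show ?case by simp
qed

lemma sinp_zero: "0 \<le> a \<Longrightarrow> 0 \<le> M \<Longrightarrow> sinp a M (\<lambda>x. 0)"
  using sinp.basis[of 0 a 0 M] by simp

lemma sinp_scale: "sinp a M f \<Longrightarrow> sinp a (\<bar>c\<bar> * M) (\<lambda>x. c * f x)"
proof (induction rule: sinp.induct)
  case (basis k d M)
  have "sinp a (\<bar>c\<bar> * M) (\<lambda>x. (c * d) * sin (of_int k * pi * x))"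
    using basis by (intro sinp.basis) (auto simp: abs_mult mult_left_mono)
  then show ?case by (simp add: mult.assoc)
next
  case (add M f N g)
  then show ?case using sinp.add[OF add.IH] by (simp add: algebra_simps)
qed

lemma sinp_diff: "sinp a M f \<Longrightarrow> sinp a N g \<Longrightarrow> sinp a (M + N) (\<lambda>x. f x - g x)"
  using sinp.add[OF _ sinp_scale[of a N g "-1"], of M f] by simp

lemma sinp_sum:
  "finite S \<Longrightarrow> 0 \<le> a \<Longrightarrow> (\<And>i. i \<in> S \<Longrightarrow> sinp a (M i) (f i)) \<Longrightarrow>
    sinp a (\<Sum>i\<in>S. M i) (\<lambda>x. \<Sum>i\<in>S. f i x)"
  by (induction S rule: finite_induct) (auto intro!: sinp.add sinp_zero)

lemma sinp_values:
  assumes "sinp a M f" shows "\<bar>f x\<bar> \<le> M" "f 0 = 0" "f 1 = 0"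
proof -
  have "\<bar>f x\<bar> \<le> M \<and> f 0 = 0 \<and> f 1 = 0"
    using assms
  proof (induction rule: sinp.induct)
    case (basis k c M)
    have "\<bar>c\<bar> * \<bar>sin (of_int k * pi * x)\<bar> \<le> \<bar>c\<bar> * 1"
      by (intro mult_left_mono) auto
    then show ?case using basis sin_integer_2pi[of "of_int k / 2"]
      by (auto simp: abs_mult sin_zero_iff_int2)
  qed auto
  then show "\<bar>f x\<bar> \<le> M" "f 0 = 0" "f 1 = 0" by auto
qed

text \<open>A first derivative turns sines into cosines and leaves the class, so it only receives a
  bound; the second derivative is a sine sum again. Each derivative costs one factor
  \<open>a\<close>.\<close>

lemma sinp_derivs:
  assumes "sinp a M f"
  shows "(f has_real_derivative deriv f x) (at x)"
    and "\<bar>deriv f x\<bar> \<le> a * M"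
    and "(deriv f has_real_derivative deriv (deriv f) x) (at x)"
    and "sinp a (a\<^sup>2 * M) (deriv (deriv f))"
proof -
  \<comment> \<open>Explicit derivatives \<open>f1\<close>, \<open>f2\<close> are carried through
    the induction, since \<open>deriv\<close> of a sum splits only once both summands are known to
    be differentiable.\<close>
  have "\<exists>f1 f2. (\<forall>x. (f has_real_derivative f1 x) (at x) \<and> (f1 has_real_derivative f2 x) (at x)
      \<and> \<bar>f1 x\<bar> \<le> a * M) \<and> sinp a (a\<^sup>2 * M) f2"
    using assms
  proof (induction rule: sinp.induct)
    case (basis k c M)
    let ?w = "of_int k * pi :: real"
    let ?f1 = "\<lambda>x. c * ?w * cos (?w * x)" and ?f2 = "\<lambda>x. (- c * ?w\<^sup>2) * sin (?w * x)"
    have "((\<lambda>x. c * sin (?w * x)) has_real_derivative ?f1 x) (at x)" for x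
      by (auto intro!: derivative_eq_intros)
    moreover have "(?f1 has_real_derivative ?f2 x) (at x)" for x
      by (auto intro!: derivative_eq_intros simp: power2_eq_square)
    moreover have "\<bar>?f1 x\<bar> \<le> a * M" for x
    proof -
      have "\<bar>?w\<bar> * \<bar>c\<bar> \<le> a * M" using basis by (intro mult_mono) auto
      moreover have "\<bar>?w\<bar> * \<bar>c\<bar> * \<bar>cos (?w * x)\<bar> \<le> \<bar>?w\<bar> * \<bar>c\<bar> * 1"
        by (intro mult_left_mono) auto
      moreover have "\<bar>?f1 x\<bar> = \<bar>?w\<bar> * \<bar>c\<bar> * \<bar>cos (?w * x)\<bar>" by (simp add: abs_mult mult_ac)
      ultimately show ?thesis by linarith
    qed
    moreover have "sinp a (a\<^sup>2 * M) ?f2"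
    proof (intro sinp.basis)
      have "?w\<^sup>2 * \<bar>c\<bar> \<le> a\<^sup>2 * M" using basis by (intro mult_mono) (auto intro: abs_le_square_iff[THEN iffD1])
      then show "\<bar>- c * ?w\<^sup>2\<bar> \<le> a\<^sup>2 * M" by (simp add: abs_mult mult_ac)
    qed (use basis in auto)
    ultimately show ?case by (intro exI[of _ ?f1] exI[of _ ?f2] conjI allI)
  next
    case (add M f N g)
    from add.IH obtain f1 f2 g1 g2 where
      f: "\<And>x. (f has_real_derivative f1 x) (at x)" "\<And>x. (f1 has_real_derivative f2 x) (at x)"
        "\<And>x. \<bar>f1 x\<bar> \<le> a * M" "sinp a (a\<^sup>2 * M) f2" and
      g: "\<And>x. (g has_real_derivative g1 x) (at x)" "\<And>x. (g1 has_real_derivative g2 x) (at x)"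
        "\<And>x. \<bar>g1 x\<bar> \<le> a * N" "sinp a (a\<^sup>2 * N) g2"
      by blast
    have "\<bar>f1 x + g1 x\<bar> \<le> a * (M + N)" for x
      using f(3)[of x] g(3)[of x] by (simp add: algebra_simps)
    then show ?case
      using sinp.add[OF f(4) g(4)]
      by (intro exI[of _ "\<lambda>x. f1 x + g1 x"] exI[of _ "\<lambda>x. f2 x + g2 x"])
        (auto intro!: DERIV_add f g simp: algebra_simps)
  qed
  then obtain f1 f2 where *: "\<And>x. (f has_real_derivative f1 x) (at x)"
      "\<And>x. (f1 has_real_derivative f2 x) (at x)" "\<And>x. \<bar>f1 x\<bar> \<le> a * M" "sinp a (a\<^sup>2 * M) f2"
    by blast
  have "deriv f = f1" "deriv f1 = f2" using *(1,2) by (auto intro!: DERIV_imp_deriv)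
  with * show "(f has_real_derivative deriv f x) (at x)" "\<bar>deriv f x\<bar> \<le> a * M"
    "(deriv f has_real_derivative deriv (deriv f) x) (at x)"
    "sinp a (a\<^sup>2 * M) (deriv (deriv f))" by simp_all
qed

text \<open>Odd times even is odd: 2 sin A cos B = sin (A + B) + sin (A - B), so frequencies add and
  no cosine appears. It serves for p * u_x and, with the roles exchanged, for \<nu>' * u. The outer
  induction is on \<open>f\<close>, the inner one on \<open>p\<close>.\<close>

lemma sinp_mult_deriv:
  assumes p: "sinp d P p" and f: "sinp a M f"
  shows "sinp (d + a) (P * (a * M)) (\<lambda>x. p x * deriv f x)"
  using f
proof (induction rule: sinp.induct)
  case f: (basis k c M)
  let ?w = "of_int k * pi :: real"
  have M: "0 \<le> M" using f by auto
  have d: "deriv (\<lambda>x. c * sin (?w * x)) = (\<lambda>x. c * ?w * cos (?w * x))"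
    by (intro ext DERIV_imp_deriv) (auto intro!: derivative_eq_intros)
  show ?case
    using p unfolding d
  proof (induction rule: sinp.induct)
    case (basis l b P)
    let ?b = "b * (c * ?w) / 2"
    have "\<bar>b\<bar> * (\<bar>?w\<bar> * \<bar>c\<bar>) \<le> P * (a * M)"
      using basis f by (intro mult_mono) auto
    then have b: "\<bar>?b\<bar> \<le> P * (a * M) / 2" by (simp add: abs_mult mult_ac)
    have "sinp (d + a) (P * (a * M) / 2 + P * (a * M) / 2)
      (\<lambda>x. ?b * sin (of_int (l + k) * pi * x) + ?b * sin (of_int (l - k) * pi * x))"
      using basis f b by (intro sinp.add sinp.basis) (auto simp: algebra_simps)
    moreover have "?b * sin (of_int (l + k) * pi * x) + ?b * sin (of_int (l - k) * pi * x)
      = b * sin (of_int l * pi * x) * (c * ?w * cos (?w * x))" for x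
      by (simp add: sin_add sin_diff ring_distribs)
    ultimately show ?case by (simp add: mult_ac)
  next
    case (add P p Q q)
    show ?case using sinp.add[OF add.IH] by (simp add: algebra_simps)
  qed
next
  case (add M f N g)
  have "deriv (\<lambda>x. f x + g x) = (\<lambda>x. deriv f x + deriv g x)"
    by (intro ext DERIV_imp_deriv DERIV_add sinp_derivs(1)[OF add.hyps(1)] sinp_derivs(1)[OF add.hyps(2)])
  then show ?case using sinp.add[OF add.IH] by (simp add: algebra_simps)
qed

subsection \<open>The wave equation with trigonometric coefficients\<close>

text \<open>Taylor coefficients in time of the solution, split by the number j of applications of the
  lower-order terms: only these raise the frequency, which makes the factorial decay win.\<close>
fun tcoeff :: "(real \<Rightarrow> real) \<Rightarrow> (real \<Rightarrow> real) \<Rightarrow> (real \<Rightarrow> real) \<Rightarrow> (real \<Rightarrow> real) \<Rightarrow>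
    nat \<Rightarrow> nat \<Rightarrow> real \<Rightarrow> real" where
  "tcoeff p q u0 u1 0 j = (if j = 0 then u0 else (\<lambda>x. 0))"
| "tcoeff p q u0 u1 (Suc 0) j = (if j = 0 then u1 else (\<lambda>x. 0))"
| "tcoeff p q u0 u1 (Suc (Suc n)) 0 = deriv (deriv (tcoeff p q u0 u1 n 0))"
| "tcoeff p q u0 u1 (Suc (Suc n)) (Suc i) =
     (\<lambda>x. deriv (deriv (tcoeff p q u0 u1 n (Suc i))) x
       - (p x * deriv (tcoeff p q u0 u1 n i) x + q x * tcoeff p q u0 u1 n i x))"

text \<open>The bound is built to reproduce itself. A second derivative costs
  \<open>(a j)\<^sup>2\<close> and raises n by 2 at fixed j; a lower-order term costs at most
  \<open>K * a i\<close> and raises n by 2 and j by 1, hence n - j by 1. The binomial coefficients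
  absorb the sum of both contributions by Pascal's rule. \<open>K\<close> adds the size of p to the
  bound \<open>d * V\<close> of \<nu>'. The condition \<open>1 \<le> a0\<close> lets terms without a
  derivative, and the initial velocity at n = 1, be charged a factor \<open>a j\<close> as
  well.\<close>

lemma sinp_tcoeff:
  assumes p: "sinp d P p" and v: "sinp d V \<nu>" and u0: "sinp a0 M u0" and u1: "sinp a0 M u1"
    and a0: "1 \<le> a0"
  defines "K \<equiv> P + d * V"
  defines "a \<equiv> (\<lambda>j. a0 + real j * d)"
  shows "sinp (a j) (M * (real (n choose j) * (K ^ j * a j ^ (n - j)))) (tcoeff p (deriv \<nu>) u0 u1 n j)"
proof (induction n arbitrary: j rule: less_induct)
  case (less n)
  let ?e = "tcoeff p (deriv \<nu>) u0 u1"
  let ?E = "\<lambda>n j. M * (real (n choose j) * (K ^ j * a j ^ (n - j)))"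
  have nn: "0 \<le> d" "0 \<le> P" "0 \<le> V" "0 \<le> M"
    using sinp_nonneg[OF p] sinp_nonneg[OF v] sinp_nonneg[OF u0] by auto
  have K: "0 \<le> K" using nn by (simp add: K_def)
  have a1: "1 \<le> a j" "a0 \<le> a j" for j using a0 nn by (auto simp: a_def add_increasing2)
  have apos: "0 \<le> a j" for j using a1[of j] by linarith
  consider "n = 0" | "n = 1" | m where "n = Suc (Suc m)"
    by (metis One_nat_def not0_implies_Suc)
  then show ?case
  proof cases
    case 1
    then show ?thesis using u0 nn apos[of j] by (cases j) (auto simp: a_def intro!: sinp_zero)
  next
    case 2
    have "sinp (a 0) (?E 1 0) u1"
      using u1 by (rule sinp_mono) (use a1[of 0] nn in \<open>auto simp: mult_le_cancel_left1\<close>)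
    then show ?thesis using 2 nn K apos by (cases j) (auto intro!: sinp_zero mult_nonneg_nonneg)
  next
    case (3 m)
    have IH: "sinp (a i) (?E m i) (?e m i)" for i using less.IH[of m] 3 by simp
    have main: "(a j)\<^sup>2 * ?E m j \<le> M * (real (m choose j) * (K ^ j * a j ^ (n - j)))" for j
    proof (cases "j \<le> m")
      case True
      then have "a j ^ (n - j) = (a j)\<^sup>2 * a j ^ (m - j)"
        using 3 by (simp add: Suc_diff_le power2_eq_square)
      then show ?thesis by simp
    qed (simp add: binomial_eq_0)
    note second = sinp_derivs(4)[OF IH]
    show ?thesis
    proof (cases j)
      case 0
      have "sinp (a 0) ((a 0)\<^sup>2 * ?E m 0) (?e n 0)" using second[of 0] 3 by simp
      then show ?thesis unfolding 0 by (rule sinp_mono) (use main[of 0] in auto)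
    next
      case (Suc i)
      have ai: "d + a i = a j" "a i + d = a j" by (simp_all add: a_def Suc algebra_simps)
      have aij: "a i \<le> a j" using ai nn by linarith
      have b1: "sinp (a j) (P * (a i * ?E m i)) (\<lambda>x. p x * deriv (?e m i) x)"
        using sinp_mult_deriv[OF p IH[of i]] by (simp add: ai)
      \<comment> \<open>Here the Taylor coefficient is the undifferentiated factor and \<nu> the
        differentiated one.\<close>
      have b2: "sinp (a j) (?E m i * (d * V)) (\<lambda>x. deriv \<nu> x * ?e m i x)"
        using sinp_mult_deriv[OF IH[of i] v] by (simp add: ai mult_ac)
      have En: "0 \<le> ?E m i" using nn K apos by simp
      \<comment> \<open>The zero-order term gets the factor \<open>a i\<close>, which is at least 1,
        to be merged with the first-order term into \<open>K\<close>.\<close>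
      have "?E m i * (d * V) \<le> ?E m i * (a i * (d * V))"
        using En mult_right_mono[OF a1(1)[of i], of "d * V"] nn by (intro mult_left_mono) auto
      then have "P * (a i * ?E m i) + ?E m i * (d * V) \<le> K * (a i * ?E m i)"
        by (simp add: K_def algebra_simps)
      also have "\<dots> \<le> M * (real (m choose i) * (K ^ j * a j ^ (n - j)))"
      proof (cases "i \<le> m")
        case True
        then have "n - j = Suc (m - i)" using 3 Suc by auto
        moreover have "a i * a i ^ (m - i) \<le> a j * a j ^ (m - i)"
          using aij apos by (intro mult_mono power_mono) auto
        then have "M * real (m choose i) * K ^ j * (a i * a i ^ (m - i))
            \<le> M * real (m choose i) * K ^ j * (a j * a j ^ (m - i))"
          using nn K by (intro mult_left_mono) auto
        ultimately show ?thesis by (simp add: Suc mult_ac)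
      qed (simp add: binomial_eq_0)
      finally have lower: "P * (a i * ?E m i) + ?E m i * (d * V)
        \<le> M * (real (m choose i) * (K ^ j * a j ^ (n - j)))" .
      \<comment> \<open>Pascal's rule applied twice, with n = m + 2 and j = i + 1; the surplus terms
        are dropped.\<close>
      have "(m choose j) + (m choose i) \<le> n choose j"
        unfolding 3 Suc by simp
      then have "real (m choose j) + real (m choose i) \<le> real (n choose j)"
        by (metis of_nat_add of_nat_le_iff)
      then have "(real (m choose j) + real (m choose i)) * (K ^ j * a j ^ (n - j))
          \<le> real (n choose j) * (K ^ j * a j ^ (n - j))"
        using K apos by (intro mult_right_mono) auto
      then have "M * ((real (m choose j) + real (m choose i)) * (K ^ j * a j ^ (n - j))) \<le> ?E n j"
        using nn by (intro mult_left_mono) auto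
      then have "(a j)\<^sup>2 * ?E m j + (P * (a i * ?E m i) + ?E m i * (d * V)) \<le> ?E n j"
        using main[of j] lower by (simp add: ring_distribs)
      moreover have "sinp (a j) ((a j)\<^sup>2 * ?E m j + (P * (a i * ?E m i) + ?E m i * (d * V))) (?e n j)"
        using sinp_diff[OF second[of j] sinp.add[OF b1 b2]] by (simp add: 3 Suc)
      ultimately show ?thesis using sinp_mono by blast
    qed
  qed
qed

text \<open>Each application of the lower-order terms takes two steps in \<open>n\<close>, so
  \<open>n\<close> steps cannot contain more than \<open>n\<close> of them.\<close>

lemma tcoeff_eq_0: "n < j \<Longrightarrow> tcoeff p q u0 u1 n j = (\<lambda>x. 0)"
proof (induction p q u0 u1 n j rule: tcoeff.induct)
  case (4 p q u0 u1 n i)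
  moreover have "deriv (\<lambda>x::real. 0::real) = (\<lambda>x. 0)" by (intro ext) simp
  ultimately show ?case by simp
qed auto

text \<open>Since (n choose j) / n! = 1 / (j! (n-j)!), each term separates. The factor y^(n-j) /
  (n-j)! is at most exp y, and exp y is geometric in j because the frequency is affine in j. What
  remains is dominated by the Cauchy product of the exponential series \<open>b\<close> with a
  geometric series.\<close>

lemma majorant_summable:
  fixes a0 d K M t :: real
  assumes "0 \<le> d" "0 \<le> a0" "0 \<le> K" "0 \<le> M"
  shows "summable (\<lambda>n. (\<Sum>j\<le>n. M * (real (n choose j) * (K ^ j * (a0 + real j * d) ^ (n - j)))) / fact n * t ^ n)"
proof -
  define s where "s = \<bar>t\<bar>"
  define b where "b = (\<lambda>j. (K * s * exp (2 * d * s)) ^ j /\<^sub>R fact j)"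
  have s: "0 \<le> s" by (simp add: s_def)
  have bpos: "0 \<le> b j" for j using assms s by (simp add: b_def)
  have sb: "summable b"
    unfolding b_def by (rule summable_exp_generic)
  have "summable (\<lambda>n. \<Sum>j\<le>n. b j * (1 / 2) ^ (n - j))"
  proof (rule summable_Cauchy_product)
    show "summable (\<lambda>j. norm (b j))" using sb bpos by simp
    show "summable (\<lambda>j. norm ((1 / 2 :: real) ^ j))" by (simp add: norm_power summable_geometric)
  qed
  then have "summable (\<lambda>n. M * exp (2 * a0 * s) * (\<Sum>j\<le>n. b j * (1 / 2) ^ (n - j)))"
    by (rule summable_mult)
  moreover have "norm ((\<Sum>j\<le>n. M * (real (n choose j) * (K ^ j * (a0 + real j * d) ^ (n - j)))) / fact n * t ^ n)
    \<le> M * exp (2 * a0 * s) * (\<Sum>j\<le>n. b j * (1 / 2) ^ (n - j))" for n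
  proof -
    have bnd: "M * (real (n choose j) * (K ^ j * (a0 + real j * d) ^ (n - j))) / fact n * s ^ n
      \<le> M * exp (2 * a0 * s) * (b j * (1 / 2) ^ (n - j))" if "j \<le> n" for j
    proof -
      define y where "y = 2 * (a0 + real j * d) * s"
      have y: "0 \<le> y" using assms s by (simp add: y_def)
      \<comment> \<open>The spare factor 2 in y yields the geometric weight 1/2 of the Cauchy product.\<close>
      have "y ^ (n - j) / fact (n - j) \<le> exp y"
        using sum_le_suminf[OF summable_exp_generic[of y], of "{n - j}"] y
        by (simp add: exp_def field_simps)
      also have "exp y = exp (2 * a0 * s) * exp (2 * d * s) ^ j"
        by (simp add: y_def exp_of_nat_mult[symmetric] exp_add[symmetric] algebra_simps)
      finally have e: "y ^ (n - j) / fact (n - j) \<le> exp (2 * a0 * s) * exp (2 * d * s) ^ j" .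
      have sn: "s ^ n = s ^ j * s ^ (n - j)" using that by (simp flip: power_add)
      have ch: "real (n choose j) / fact n = 1 / (fact j * fact (n - j))"
        using that by (simp add: binomial_fact field_simps)
      have yn: "y ^ (n - j) = 2 ^ (n - j) * ((a0 + real j * d) ^ (n - j) * s ^ (n - j))"
        by (simp only: y_def power_mult_distrib mult.assoc)
      have "M * (real (n choose j) * (K ^ j * (a0 + real j * d) ^ (n - j))) / fact n * s ^ n
        = M * (K ^ j * s ^ j) * (real (n choose j) / fact n) * ((a0 + real j * d) ^ (n - j) * s ^ (n - j))"
        by (simp add: sn mult_ac)
      also have "\<dots> = M * (K ^ j * s ^ j / fact j) * (1 / 2) ^ (n - j) * (y ^ (n - j) / fact (n - j))"
        unfolding ch yn by (simp add: power_one_over field_simps)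
      also have "\<dots> \<le> M * (K ^ j * s ^ j / fact j) * (1 / 2) ^ (n - j) * (exp (2 * a0 * s) * exp (2 * d * s) ^ j)"
        using assms s e by (intro mult_left_mono) auto
      also have "\<dots> = M * exp (2 * a0 * s) * (b j * (1 / 2) ^ (n - j))"
        by (simp add: b_def power_mult_distrib divide_simps)
      finally show ?thesis .
    qed
    have "norm ((\<Sum>j\<le>n. M * (real (n choose j) * (K ^ j * (a0 + real j * d) ^ (n - j)))) / fact n * t ^ n)
      = (\<Sum>j\<le>n. M * (real (n choose j) * (K ^ j * (a0 + real j * d) ^ (n - j)))) / fact n * s ^ n"
      using assms by (simp add: abs_mult s_def power_abs sum_nonneg)
    also have "\<dots> = (\<Sum>j\<le>n. M * (real (n choose j) * (K ^ j * (a0 + real j * d) ^ (n - j))) / fact n * s ^ n)"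
      by (simp only: sum_divide_distrib sum_distrib_right)
    also have "\<dots> \<le> (\<Sum>j\<le>n. M * exp (2 * a0 * s) * (b j * (1 / 2) ^ (n - j)))"
      by (intro sum_mono bnd) auto
    finally show ?thesis by (simp only: sum_distrib_left)
  qed
  ultimately show ?thesis by (rule summable_comparison_test'[where N = 0])
qed

section \<open>Summing the power series in time\<close>

lemma has_field_derivative_series_bounded:
  fixes f f' :: "nat \<Rightarrow> real \<Rightarrow> real"
  assumes f: "\<And>n x. (f n has_real_derivative f' n x) (at x)"
    and B: "summable B" "\<And>n x. \<bar>f n x\<bar> \<le> B n" and B': "summable B'" "\<And>n x. \<bar>f' n x\<bar> \<le> B' n"
  shows "((\<lambda>x. \<Sum>n. f n x) has_real_derivative (\<Sum>n. f' n x)) (at x)"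
proof (rule has_field_derivative_series'(2)[of UNIV])
  show "uniformly_convergent_on UNIV (\<lambda>n x. \<Sum>i<n. f' i x)"
    using B' by (intro Weierstrass_m_test'[where M = B']) auto
  show "summable (\<lambda>n. f n 0)" using B by (intro summable_comparison_test'[OF B(1)]) auto
qed (use f in auto)

text \<open>A frequency bound \<open>b * 2 ^ n\<close> is affordable because summability is assumed
  for every t: one space derivative multiplies the majorant by 2^n, two by 4^n, and both powers are
  absorbed by rescaling t. All series can then be differentiated term by term.\<close>

lemma power_series_solution:
  fixes v :: "nat \<Rightarrow> real \<Rightarrow> real" and N :: "nat \<Rightarrow> real"
  assumes v: "\<And>n. sinp (b * 2 ^ n) (N n) (v n)"
    and N: "\<And>t. summable (\<lambda>n. N n / fact n * t ^ n)"
    and rec: "\<And>n x. v (Suc (Suc n)) x = deriv (deriv (v n)) x - (p x * deriv (v n) x + q x * v n x)"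
  obtains u ut utt ux uxx :: "real \<Rightarrow> real \<Rightarrow> real" where
    "\<And>t x. ((\<lambda>s. u s x) has_real_derivative ut t x) (at t)"
    "\<And>t x. ((\<lambda>s. ut s x) has_real_derivative utt t x) (at t)"
    "\<And>t x. (u t has_real_derivative ux t x) (at x)"
    "\<And>t x. (ux t has_real_derivative uxx t x) (at x)"
    "\<And>t x. utt t x - uxx t x + p x * ux t x + q x * u t x = 0"
    "\<And>x. u 0 x = v 0 x" "\<And>x. ut 0 x = v 1 x"
    "\<And>t. u t 0 = 0" "\<And>t. u t 1 = 0"
    "\<And>T. \<exists>B. \<forall>t\<in>{0..T}. \<forall>x. \<bar>u t x\<bar> \<le> B \<and> \<bar>ux t x\<bar> \<le> B"
proof -
  \<comment> \<open>\<open>U k\<close> is the k-th time derivative: for coefficients divided by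
    \<open>fact n\<close>, differentiating in t shifts the index by one.\<close>
  define U where "U = (\<lambda>k t x. \<Sum>n. v (n + k) x / fact n * t ^ n)"
  define ux where "ux = (\<lambda>t x. \<Sum>n. deriv (v n) x / fact n * t ^ n)"
  define uxx where "uxx = (\<lambda>t x. \<Sum>n. deriv (deriv (v n)) x / fact n * t ^ n)"
  have nn: "0 \<le> N n" for n using sinp_nonneg[OF v] by auto
  have b: "0 \<le> b" using sinp_nonneg[OF v[of 0]] by auto
  have sm: "summable (\<lambda>n. c * N n * r ^ n / fact n * \<bar>t\<bar> ^ n)" for c r t
    using summable_mult[OF N[of "r * \<bar>t\<bar>"], of c] by (simp add: power_mult_distrib mult_ac)
  have term_le: "\<bar>y / fact n * t ^ n\<bar> \<le> B / fact n * \<bar>t\<bar> ^ n" if "\<bar>y\<bar> \<le> B" for y B t :: real and n :: nat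
  proof -
    have "\<bar>y\<bar> / fact n * \<bar>t\<bar> ^ n \<le> B / fact n * \<bar>t\<bar> ^ n"
      using that by (intro mult_right_mono divide_right_mono) auto
    then show ?thesis by (simp add: abs_mult power_abs)
  qed
  have v0: "\<bar>v n x / fact n * t ^ n\<bar> \<le> 1 * N n * 1 ^ n / fact n * \<bar>t\<bar> ^ n" for n x t
    using term_le[OF sinp_values(1)[OF v[of n]]] by simp
  have v1: "\<bar>deriv (v n) x / fact n * t ^ n\<bar> \<le> b * N n * 2 ^ n / fact n * \<bar>t\<bar> ^ n" for n x t
  proof (rule term_le)
    show "\<bar>deriv (v n) x\<bar> \<le> b * N n * 2 ^ n"
      using sinp_derivs(2)[OF v[of n], of x] by (simp add: mult_ac)
  qed
  have v2: "\<bar>deriv (deriv (v n)) x / fact n * t ^ n\<bar> \<le> b\<^sup>2 * N n * 4 ^ n / fact n * \<bar>t\<bar> ^ n" for n x t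
  proof (rule term_le)
    have "(2 ^ n)\<^sup>2 = (4::real) ^ n" by (simp add: power2_eq_square flip: power_mult_distrib)
    then show "\<bar>deriv (deriv (v n)) x\<bar> \<le> b\<^sup>2 * N n * 4 ^ n"
      using sinp_values(1)[OF sinp_derivs(4)[OF v[of n]], of x]
      by (simp add: power_mult_distrib mult_ac)
  qed
  \<comment> \<open>The shifted series is the k-fold termwise derivative of an everywhere convergent
    power series, hence converges everywhere.\<close>
  have S0: "summable (\<lambda>n. v (n + k) x / fact n * t ^ n)" for k t x
  proof (induction k arbitrary: t)
    case 0
    show ?case
      by (rule summable_comparison_test'[where N = 0, OF sm[of 1 1 t]])
        (simp only: real_norm_def add_0_right v0)
  next
    case (Suc k)
    have "summable (\<lambda>n. diffs (\<lambda>n. v (n + k) x / fact n) n * t ^ n)"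
      by (rule termdiff_converges_all) (rule Suc)
    then show ?case by (simp add: diffs_def fact_Suc field_simps del: of_nat_Suc)
  qed
  have Ut: "((\<lambda>s. U k s x) has_real_derivative U (Suc k) t x) (at t)" for k t x
    using termdiffs_strong_converges_everywhere[of "\<lambda>n. v (n + k) x / fact n" t, OF S0]
    by (simp add: U_def diffs_def fact_Suc field_simps del: of_nat_Suc)
  have S1: "summable (\<lambda>n. deriv (v n) x / fact n * t ^ n)" for t x
    by (rule summable_comparison_test'[where N = 0, OF sm[of b 2 t]]) (simp only: real_norm_def v1)
  have S2: "summable (\<lambda>n. deriv (deriv (v n)) x / fact n * t ^ n)" for t x
    by (rule summable_comparison_test'[where N = 0, OF sm[of "b\<^sup>2" 4 t]]) (simp only: real_norm_def v2)
  have D1: "((\<lambda>x. v n x / fact n * t ^ n) has_real_derivative deriv (v n) x / fact n * t ^ n) (at x)" for n t x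
    by (intro DERIV_cmult_right DERIV_cdivide sinp_derivs(1)[OF v])
  have D2: "((\<lambda>x. deriv (v n) x / fact n * t ^ n) has_real_derivative deriv (deriv (v n)) x / fact n * t ^ n) (at x)" for n t x
    by (intro DERIV_cmult_right DERIV_cdivide sinp_derivs(3)[OF v])
  have Ux: "(U 0 t has_real_derivative ux t x) (at x)" for t x
    unfolding U_def ux_def add_0_right
    by (rule has_field_derivative_series_bounded[OF D1 sm v0 sm v1])
  have Uxx: "(ux t has_real_derivative uxx t x) (at x)" for t x
    unfolding uxx_def ux_def
    by (rule has_field_derivative_series_bounded[OF D2 sm v1 sm v2])
  have pde: "U 2 t x - uxx t x + p x * ux t x + q x * U 0 t x = 0" for t x
  proof -
    have "(\<lambda>n. deriv (deriv (v n)) x / fact n * t ^ n - (p x * (deriv (v n) x / fact n * t ^ n)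
        + q x * (v n x / fact n * t ^ n))) sums (uxx t x - (p x * ux t x + q x * U 0 t x))"
      unfolding uxx_def ux_def U_def using S0[of 0]
      by (intro sums_diff sums_add sums_mult summable_sums S1 S2) auto
    moreover have "deriv (deriv (v n)) x / fact n * t ^ n - (p x * (deriv (v n) x / fact n * t ^ n)
        + q x * (v n x / fact n * t ^ n)) = v (n + 2) x / fact n * t ^ n" for n
      by (simp add: rec field_simps)
    ultimately have "U 2 t x = uxx t x - (p x * ux t x + q x * U 0 t x)"
      unfolding U_def by (simp add: sums_iff)
    then show ?thesis by simp
  qed
  have bd: "\<exists>B. \<forall>t\<in>{0..T}. \<forall>x. \<bar>U 0 t x\<bar> \<le> B \<and> \<bar>ux t x\<bar> \<le> B" for T
  proof -
    have *: "\<bar>\<Sum>n. f n\<bar> \<le> (\<Sum>n. c * N n * r ^ n / fact n * \<bar>T\<bar> ^ n)"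
      if f: "\<And>n. \<bar>f n\<bar> \<le> c * N n * r ^ n / fact n * \<bar>t\<bar> ^ n" and t: "t \<in> {0..T}" and c: "0 \<le> c" "0 \<le> r"
      for f :: "nat \<Rightarrow> real" and t c r
    proof -
      have le: "\<bar>f n\<bar> \<le> c * N n * r ^ n / fact n * \<bar>T\<bar> ^ n" for n
        using t c nn by (intro order_trans[OF f] mult_left_mono power_mono) auto
      have "summable (\<lambda>n. \<bar>f n\<bar>)" by (rule summable_comparison_test'[OF sm, of 0]) (use le in auto)
      then have "\<bar>\<Sum>n. f n\<bar> \<le> (\<Sum>n. \<bar>f n\<bar>)" by (rule summable_rabs)
      also have "\<dots> \<le> (\<Sum>n. c * N n * r ^ n / fact n * \<bar>T\<bar> ^ n)"
        using \<open>summable (\<lambda>n. \<bar>f n\<bar>)\<close> sm le by (intro suminf_le) auto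
      finally show ?thesis .
    qed
    have "\<bar>U 0 t x\<bar> \<le> max (\<Sum>n. 1 * N n * 1 ^ n / fact n * \<bar>T\<bar> ^ n) (\<Sum>n. b * N n * 2 ^ n / fact n * \<bar>T\<bar> ^ n)
      \<and> \<bar>ux t x\<bar> \<le> max (\<Sum>n. 1 * N n * 1 ^ n / fact n * \<bar>T\<bar> ^ n) (\<Sum>n. b * N n * 2 ^ n / fact n * \<bar>T\<bar> ^ n)"
      if "t \<in> {0..T}" for t x
      using *[OF v0[of _ x t] that] *[OF v1[of _ x t] that b] by (auto simp: U_def ux_def)
    then show ?thesis by blast
  qed
  have U0: "U k 0 x = v k x" for k x
    unfolding U_def using powser_zero[of "\<lambda>n. v (n + k) x / fact n"] by simp
  have bdry: "U 0 t 0 = 0" "U 0 t 1 = 0" for t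
    using sinp_values(2,3)[OF v] by (simp_all add: U_def)
  show thesis
    by (rule that[of "U 0" "U 1" "U 2" ux uxx])
      (use Ut[of 0] Ut[of 1] Ux Uxx pde U0 bdry bd in \<open>simp_all add: numeral_2_eq_2\<close>)
qed

lemma wave_equation_sinp:
  assumes p: "sinp d1 P p" and v: "sinp d2 V \<nu>" and u0: "sinp a1 M1 u0" and u1: "sinp a2 M2 u1"
  obtains u ut utt ux uxx :: "real \<Rightarrow> real \<Rightarrow> real" where
    "\<And>t x. ((\<lambda>s. u s x) has_real_derivative ut t x) (at t)"
    "\<And>t x. ((\<lambda>s. ut s x) has_real_derivative utt t x) (at t)"
    "\<And>t x. (u t has_real_derivative ux t x) (at x)"
    "\<And>t x. (ux t has_real_derivative uxx t x) (at x)"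
    "\<And>t x. utt t x - uxx t x + p x * ux t x + deriv \<nu> x * u t x = 0"
    "\<And>x. u 0 x = u0 x" "\<And>x. ut 0 x = u1 x"
    "\<And>t. u t 0 = 0" "\<And>t. u t 1 = 0"
    "\<And>T. \<exists>B. \<forall>t\<in>{0..T}. \<forall>x. \<bar>u t x\<bar> \<le> B \<and> \<bar>ux t x\<bar> \<le> B"
proof -
  define d where "d = max d1 d2"
  define a0 where "a0 = max 1 (max a1 a2)"
  define M where "M = max M1 M2"
  define K where "K = P + d * V"
  define N where "N = (\<lambda>n. \<Sum>j\<le>n. M * (real (n choose j) * (K ^ j * (a0 + real j * d) ^ (n - j))))"
  let ?e = "tcoeff p (deriv \<nu>) u0 u1"
  \<comment> \<open>Summing over j undoes the splitting in \<open>tcoeff\<close> and restores the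
    plain Taylor recursion.\<close>
  define w where "w = (\<lambda>n x. \<Sum>j\<le>n. ?e n j x)"
  note nn = sinp_nonneg[OF p] sinp_nonneg[OF v] sinp_nonneg[OF u0]
  have pos: "0 \<le> d" "1 \<le> a0" "0 \<le> M" "0 \<le> K" using nn by (auto simp: d_def a0_def M_def K_def)
  have e: "sinp (a0 + real j * d) (M * (real (n choose j) * (K ^ j * (a0 + real j * d) ^ (n - j)))) (?e n j)" for n j
    unfolding K_def
    by (rule sinp_tcoeff; (rule sinp_mono[OF p] sinp_mono[OF v] sinp_mono[OF u0] sinp_mono[OF u1])?)
      (use pos in \<open>auto simp: d_def a0_def M_def\<close>)
  \<comment> \<open>The frequencies a0 + j*d with j \<le> n grow only linearly, so j < 2^n fits them
    to the geometric form asked for by \<open>power_series_solution\<close>.\<close>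
  have "sinp ((a0 + d) * 2 ^ n) (N n) (w n)" for n
    unfolding N_def w_def
  proof (rule sinp_sum)
    fix j assume "j \<in> {..n}"
    then have "real j \<le> real n" by simp
    also have "\<dots> \<le> 2 ^ n" using of_nat_less_two_power[of n, where 'a = real] by simp
    finally have "real j * d \<le> 2 ^ n * d" using pos by (intro mult_right_mono) auto
    moreover have "a0 * 1 \<le> a0 * 2 ^ n" using pos by (intro mult_left_mono) auto
    ultimately show "sinp ((a0 + d) * 2 ^ n)
        (M * (real (n choose j) * (K ^ j * (a0 + real j * d) ^ (n - j)))) (?e n j)"
      by (intro sinp_mono[OF e]) (auto simp: algebra_simps)
  qed (use pos in auto)
  moreover have "summable (\<lambda>n. N n / fact n * t ^ n)" for t
    unfolding N_def using pos by (intro majorant_summable) auto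
  moreover have "w (Suc (Suc n)) x = deriv (deriv (w n)) x - (p x * deriv (w n) x + deriv \<nu> x * w n x)" for n x
  proof -
    have d1: "deriv (w n) = (\<lambda>x. \<Sum>j\<le>n. deriv (?e n j) x)"
      unfolding w_def by (intro ext DERIV_imp_deriv DERIV_sum sinp_derivs(1)[OF e])
    have d2: "deriv (deriv (w n)) = (\<lambda>x. \<Sum>j\<le>n. deriv (deriv (?e n j)) x)"
      unfolding d1 by (intro ext DERIV_imp_deriv DERIV_sum sinp_derivs(3)[OF e])
    have z: "?e n j = (\<lambda>x. 0)" if "n < j" for j using that by (rule tcoeff_eq_0)
    have dz: "deriv (\<lambda>x::real. 0::real) = (\<lambda>x. 0)" by (intro ext) simp
    \<comment> \<open>The index j = 0 has its own recursion clause and is split off; afterwards the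
      second derivatives recombine into one sum, and all terms with j > n vanish.\<close>
    have "w (Suc (Suc n)) x = deriv (deriv (?e n 0)) x + (\<Sum>i\<le>Suc n. deriv (deriv (?e n (Suc i))) x)
        - (\<Sum>i\<le>Suc n. p x * deriv (?e n i) x + deriv \<nu> x * ?e n i x)"
      unfolding w_def sum.atMost_Suc_shift[of _ "Suc n"] tcoeff.simps sum_subtractf by simp
    also have "deriv (deriv (?e n 0)) x + (\<Sum>i\<le>Suc n. deriv (deriv (?e n (Suc i))) x)
        = (\<Sum>j\<le>Suc (Suc n). deriv (deriv (?e n j)) x)"
      by (rule sum.atMost_Suc_shift[symmetric])
    also have "\<dots> = (\<Sum>j\<le>n. deriv (deriv (?e n j)) x)"
      by (simp add: z dz)
    also have "(\<Sum>i\<le>Suc n. p x * deriv (?e n i) x + deriv \<nu> x * ?e n i x)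
        = (\<Sum>i\<le>n. p x * deriv (?e n i) x + deriv \<nu> x * ?e n i x)"
      by (simp add: z dz)
    finally have *: "w (Suc (Suc n)) x = (\<Sum>j\<le>n. deriv (deriv (?e n j)) x)
        - (\<Sum>i\<le>n. p x * deriv (?e n i) x + deriv \<nu> x * ?e n i x)" .
    show ?thesis
      unfolding * d2 unfolding d1 by (simp add: w_def sum.distrib sum_distrib_left)
  qed
  ultimately obtain u ut utt ux uxx :: "real \<Rightarrow> real \<Rightarrow> real" where *:
    "\<And>t x. ((\<lambda>s. u s x) has_real_derivative ut t x) (at t)"
    "\<And>t x. ((\<lambda>s. ut s x) has_real_derivative utt t x) (at t)"
    "\<And>t x. (u t has_real_derivative ux t x) (at x)"
    "\<And>t x. (ux t has_real_derivative uxx t x) (at x)"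
    "\<And>t x. utt t x - uxx t x + p x * ux t x + deriv \<nu> x * u t x = 0"
    "\<And>x. u 0 x = w 0 x" "\<And>x. ut 0 x = w 1 x"
    "\<And>t. u t 0 = 0" "\<And>t. u t 1 = 0"
    "\<And>T. \<exists>B. \<forall>t\<in>{0..T}. \<forall>x. \<bar>u t x\<bar> \<le> B \<and> \<bar>ux t x\<bar> \<le> B"
    by (rule power_series_solution) blast
  have "w 0 = u0" "w 1 = u1" by (simp_all add: w_def)
  then show thesis using that[of u ut utt ux uxx] * by simp
qed

subsection \<open>Smooth functions and mollifiers\<close>

text \<open>For functions whose derivatives of all orders are known in closed form: iterated
  \<open>deriv\<close> is identified with the given sequence by induction.\<close>

lemma smooth_everywhereI_jet:
  assumes "F 0 = f" and F: "\<And>n x. (F n has_real_derivative F (Suc n) x) (at x)"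
  shows "smooth_everywhere f" and "(deriv ^^ n) f = F n"
proof -
  have *: "(deriv ^^ n) f = F n" for n
  proof (induction n)
    case (Suc n)
    then show ?case using F[of n] by (auto intro!: DERIV_imp_deriv)
  qed (use assms in auto)
  show "(deriv ^^ n) f = F n" by (rule *)
  show "smooth_everywhere f"
    unfolding smooth_everywhere_def * using F by (auto simp: real_differentiable_def)
qed

lemma smooth_everywhere_DERIV:
  "smooth_everywhere f \<Longrightarrow> ((deriv ^^ n) f has_real_derivative (deriv ^^ Suc n) f x) (at x)"
  by (simp add: smooth_everywhere_def DERIV_deriv_iff_real_differentiable)

lemma smooth_everywhere_continuous: "smooth_everywhere f \<Longrightarrow> continuous_on A ((deriv ^^ n) f)"
  by (meson DERIV_isCont continuous_at_imp_continuous_on smooth_everywhere_DERIV)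

lemma smooth_everywhere_continuous0: "smooth_everywhere f \<Longrightarrow> continuous_on A f"
  using smooth_everywhere_continuous[of f A 0] by simp

text \<open>For functions whose n-th derivative has no convenient formula: it suffices to exhibit a
  class that differentiation does not leave.\<close>

lemma smooth_everywhereI_closed:
  assumes "f \<in> S" and S: "\<And>f. f \<in> S \<Longrightarrow> \<exists>f'\<in>S. \<forall>x. (f has_real_derivative f' x) (at x)"
  shows "smooth_everywhere f"
proof -
  have "(deriv ^^ n) f \<in> S" for n
  proof (induction n)
    case (Suc n)
    then obtain f' where f': "f' \<in> S" "\<And>x. ((deriv ^^ n) f has_real_derivative f' x) (at x)"
      using S by blast
    then have "deriv ((deriv ^^ n) f) = f'" by (auto intro!: DERIV_imp_deriv)
    then show ?case using f' by simp
  qed (use assms in auto)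
  then show ?thesis
    using S unfolding smooth_everywhere_def real_differentiable_def by blast
qed

lemma smooth_everywhere_lincomb:
  assumes f: "smooth_everywhere f" and g: "smooth_everywhere g"
  shows "smooth_everywhere (\<lambda>x. c * f x + d * g x)"
    and "(deriv ^^ n) (\<lambda>x. c * f x + d * g x) = (\<lambda>x. c * (deriv ^^ n) f x + d * (deriv ^^ n) g x)"
proof -
  let ?F = "\<lambda>n x. c * (deriv ^^ n) f x + d * (deriv ^^ n) g x"
  have "(?F n has_real_derivative ?F (Suc n) x) (at x)" for n x
    by (intro DERIV_add DERIV_cmult smooth_everywhere_DERIV f g)
  then show "smooth_everywhere (\<lambda>x. c * f x + d * g x)" "(deriv ^^ n) (\<lambda>x. c * f x + d * g x) = ?F n"
    using smooth_everywhereI_jet[of ?F] by auto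
qed

lemma smooth_everywhere_affine:
  assumes f: "smooth_everywhere f"
  shows "smooth_everywhere (\<lambda>x. f (a * x + b))"
    and "(deriv ^^ n) (\<lambda>x. f (a * x + b)) = (\<lambda>x. a ^ n * (deriv ^^ n) f (a * x + b))"
proof -
  let ?F = "\<lambda>n x. a ^ n * (deriv ^^ n) f (a * x + b)"
  have "(?F n has_real_derivative ?F (Suc n) x) (at x)" for n x
  proof -
    have "((\<lambda>x. (deriv ^^ n) f (a * x + b)) has_real_derivative (deriv ^^ Suc n) f (a * x + b) * a) (at x)"
      by (rule DERIV_chain2[OF smooth_everywhere_DERIV[OF f]]) (auto intro!: derivative_eq_intros)
    then show ?thesis by (auto dest: DERIV_cmult[where c = "a ^ n"] simp: mult_ac)
  qed
  then show "smooth_everywhere (\<lambda>x. f (a * x + b))" "(deriv ^^ n) (\<lambda>x. f (a * x + b)) = ?F n"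
    using smooth_everywhereI_jet[of ?F] by auto
qed

text \<open>The derivative of a product is a sum of two products, so sums of products are closed
  under differentiation; this stands in for the general Leibniz formula.\<close>

inductive_set smooth_products :: "(real \<Rightarrow> real) set" where
  prod: "smooth_everywhere f \<Longrightarrow> smooth_everywhere g \<Longrightarrow> (\<lambda>x. f x * g x) \<in> smooth_products"
| add: "h \<in> smooth_products \<Longrightarrow> k \<in> smooth_products \<Longrightarrow> (\<lambda>x. h x + k x) \<in> smooth_products"

lemma smooth_everywhere_deriv: "smooth_everywhere f \<Longrightarrow> smooth_everywhere (deriv f)"
  unfolding smooth_everywhere_def by (metis funpow_Suc_right o_apply)

lemma smooth_everywhere_mult:
  assumes f: "smooth_everywhere f" and g: "smooth_everywhere g"
  shows "smooth_everywhere (\<lambda>x. f x * g x)"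
proof (rule smooth_everywhereI_closed)
  show "(\<lambda>x. f x * g x) \<in> smooth_products" using f g by (rule smooth_products.prod)
  show "\<exists>f'\<in>smooth_products. \<forall>x. (h has_real_derivative f' x) (at x)" if "h \<in> smooth_products" for h
    using that
  proof induction
    case (prod f g)
    have "(\<lambda>x. deriv f x * g x + deriv g x * f x) \<in> smooth_products"
      using prod by (intro smooth_products.intros smooth_everywhere_deriv)
    moreover have "((\<lambda>x. f x * g x) has_real_derivative deriv f x * g x + deriv g x * f x) (at x)" for x
      using smooth_everywhere_DERIV[of _ 0] prod by (auto intro!: DERIV_mult)
    ultimately show ?case by (intro bexI) auto
  next
    case (add h k)
    then obtain h' k' where "h' \<in> smooth_products" "k' \<in> smooth_products"
      "\<And>x. (h has_real_derivative h' x) (at x)" "\<And>x. (k has_real_derivative k' x) (at x)"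
      by blast
    then show ?case
      by (intro bexI[of _ "\<lambda>x. h' x + k' x"]) (auto intro!: DERIV_add smooth_products.intros)
  qed
qed

text \<open>Combinations of x^(-k) exp (-1/x), extended by 0 to x \<le> 0. Differentiating one such
  term yields two of the same kind, so the class is closed under differentiation.\<close>

inductive_set flat_functions :: "(real \<Rightarrow> real) set" where
  monom: "(\<lambda>x. if 0 < x then c * (1 / x) ^ k * exp (- (1 / x)) else 0) \<in> flat_functions"
| add: "h \<in> flat_functions \<Longrightarrow> k \<in> flat_functions \<Longrightarrow> (\<lambda>x. h x + k x) \<in> flat_functions"

lemma flat_monom_tendsto_0:
  "((\<lambda>x::real. c * (1 / x) ^ k * exp (- (1 / x))) \<longlongrightarrow> 0) (at_right 0)"
proof -
  have "((\<lambda>y::real. y ^ k / exp y) \<longlongrightarrow> 0) at_top" by (rule tendsto_power_div_exp_0)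
  then have "((\<lambda>x::real. inverse x ^ k / exp (inverse x)) \<longlongrightarrow> 0) (at_right 0)"
    by (rule filterlim_compose) (rule filterlim_inverse_at_top_right)
  then have "((\<lambda>x::real. c * (inverse x ^ k / exp (inverse x))) \<longlongrightarrow> c * 0) (at_right 0)"
    by (intro tendsto_mult) auto
  then show ?thesis by (simp add: exp_minus field_simps)
qed

text \<open>Only x = 0 is delicate. There the right difference quotient is the same expression with
  k + 1 in place of k, which tends to 0, and the left one is identically 0.\<close>

lemma flat_monom_deriv:
  fixes c x :: real
  defines "f \<equiv> \<lambda>c k (x::real). if 0 < x then c * (1 / x) ^ k * exp (- (1 / x)) else (0::real)"
  shows "(f c k has_real_derivative (f (- c * real k) (Suc k) x + f c (k + 2) x)) (at x)"
proof -
  consider "0 < x" | "x < 0" | "x = 0" by linarith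
  then show ?thesis
  proof cases
    case 1
    have r: "((\<lambda>x. 1 / x) has_real_derivative - (1 / x\<^sup>2)) (at x)"
      using 1 by (auto intro!: derivative_eq_intros simp: power2_eq_square field_simps)
    have e: "((\<lambda>x. exp (- (1 / x))) has_real_derivative exp (- (1 / x)) * (1 / x\<^sup>2)) (at x)"
      using DERIV_fun_exp[OF DERIV_minus[OF r]] by simp
    note DERIV_mult[OF DERIV_cmult[OF DERIV_power[OF r, of k], of c] e]
    also have "c * (real k * (- (1 / x\<^sup>2) * (1 / x) ^ (k - Suc 0))) * exp (- (1 / x))
        + exp (- (1 / x)) * (1 / x\<^sup>2) * (c * (1 / x) ^ k)
      = f (- c * real k) (Suc k) x + f c (k + 2) x"
      using 1 by (cases k) (auto simp: f_def power2_eq_square field_simps)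
    finally show ?thesis
      using has_field_derivative_transform_within_open[of _ _ x "{0<..}" "f c k"] 1 by (auto simp: f_def)
  next
    case 2
    have "(f c k has_real_derivative 0) (at x)"
      by (rule has_field_derivative_transform_within_open[of "\<lambda>x. 0" _ _ "{..<0}"]) (use 2 in \<open>auto simp: f_def\<close>)
    then show ?thesis using 2 by (simp add: f_def)
  next
    case 3
    have "((\<lambda>h. f c k h / h) \<longlongrightarrow> 0) (at_right 0)"
    proof (rule Lim_transform_eventually[OF flat_monom_tendsto_0[of c "Suc k"]])
      show "\<forall>\<^sub>F x in at_right 0. c * (1 / x) ^ Suc k * exp (- (1 / x)) = f c k x / x"
        by (auto simp: f_def eventually_at_right_field field_simps intro: exI[of _ 1])
    qed
    moreover have "((\<lambda>h. f c k h / h) \<longlongrightarrow> 0) (at_left 0)"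
    proof (rule Lim_transform_eventually[OF tendsto_const[of 0]])
      show "\<forall>\<^sub>F x in at_left 0. 0 = f c k x / x"
        by (auto simp: f_def eventually_at_left_field intro: exI[of _ "-1"])
    qed
    ultimately have "((\<lambda>h. f c k h / h) \<longlongrightarrow> 0) (at 0)"
      by (simp add: filterlim_at_split)
    then have "(f c k has_real_derivative 0) (at 0)"
      by (simp add: DERIV_def f_def cong: if_cong)
    then show ?thesis using 3 by (simp add: f_def)
  qed
qed

lemma smooth_everywhere_flat:
  "smooth_everywhere (\<lambda>x. if 0 < x then exp (- (1 / x)) else 0)"
proof (rule smooth_everywhereI_closed)
  show "(\<lambda>x. if 0 < x then exp (- (1 / x)) else 0) \<in> flat_functions"
    using flat_functions.monom[of 1 0] by (simp cong: if_cong)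
  show "\<exists>f'\<in>flat_functions. \<forall>x. (h has_real_derivative f' x) (at x)" if "h \<in> flat_functions" for h
    using that
  proof induction
    case (monom c k)
    show ?case
      using flat_monom_deriv[of c k] flat_functions.add[OF flat_functions.monom[of "- c * real k" "Suc k"] flat_functions.monom[of c "k + 2"]]
      by (intro bexI allI)
  next
    case (add h k)
    then obtain h' k' where "h' \<in> flat_functions" "k' \<in> flat_functions"
      "\<And>x. (h has_real_derivative h' x) (at x)" "\<And>x. (k has_real_derivative k' x) (at x)"
      by blast
    then show ?case
      by (intro bexI[of _ "\<lambda>x. h' x + k' x"]) (auto intro!: DERIV_add flat_functions.intros)
  qed
qed

section \<open>Supports and mollifiers\<close>

lemma supported_in_mono: "supported_in f a b \<Longrightarrow> c \<le> a \<Longrightarrow> b \<le> d \<Longrightarrow> supported_in f c d"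
  by (auto simp: supported_in_def)

lemma supported_in_derivs:
  assumes "supported_in f a b" shows "supported_in ((deriv ^^ n) f) a b"
proof (induction n)
  case (Suc n)
  have "deriv ((deriv ^^ n) f) x = 0" if "x \<notin> {a..b}" for x
  proof -
    have "((deriv ^^ n) f has_real_derivative 0) (at x)"
    proof (rule has_field_derivative_transform_within_open)
      show "((\<lambda>x. 0) has_real_derivative 0) (at x)" by simp
      show "open (- {a..b})" by auto
      show "x \<in> - {a..b}" using that by simp
      show "0 = (deriv ^^ n) f y" if "y \<in> - {a..b}" for y
        using Suc that by (auto simp: supported_in_def)
    qed
    then show ?thesis by (rule DERIV_imp_deriv)
  qed
  then show ?case by (simp add: supported_in_def)
qed (use assms in auto)

lemma supported_in_bounded:
  assumes "smooth_everywhere f" "supported_in f a b"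
  obtains B where "0 \<le> B" "\<And>x. \<bar>(deriv ^^ n) f x\<bar> \<le> B"
proof -
  have "compact ((deriv ^^ n) f ` {a..b})"
    using assms by (intro compact_continuous_image smooth_everywhere_continuous) auto
  then obtain B where B: "\<And>x. x \<in> {a..b} \<Longrightarrow> \<bar>(deriv ^^ n) f x\<bar> \<le> B"
    by (metis (no_types, lifting) bounded_iff compact_imp_bounded imageI real_norm_def)
  have "\<bar>(deriv ^^ n) f x\<bar> \<le> max 0 B" for x
    using B[of x] supported_in_derivs[OF assms(2), of n] by (cases "x \<in> {a..b}") (auto simp: supported_in_def)
  then show thesis by (intro that[of "max 0 B"]) auto
qed

text \<open>The product of exp (-1/x) evaluated at \<delta> - x and \<delta> + x lives on
  (-\<delta>, \<delta>). Its integral is positive because it is continuous, nonnegative and nonzero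
  at 0, so it can be normalised.\<close>

lemma mollifier_exists:
  fixes \<delta> :: real assumes \<delta>: "0 < \<delta>"
  obtains \<rho> where "smooth_everywhere \<rho>" "supported_in \<rho> (- \<delta>) \<delta>" "\<And>x. 0 \<le> \<rho> x"
    "(\<rho> has_integral 1) {- \<delta>..\<delta>}"
proof -
  define \<eta> :: "real \<Rightarrow> real" where "\<eta> = (\<lambda>x. if 0 < x then exp (- (1 / x)) else 0)"
  define \<beta> where "\<beta> = (\<lambda>x. \<eta> (- 1 * x + \<delta>) * \<eta> (1 * x + \<delta>))"
  define I where "I = integral {- \<delta>..\<delta>} \<beta>"
  have sm: "smooth_everywhere \<beta>"
    unfolding \<beta>_def \<eta>_def by (intro smooth_everywhere_mult smooth_everywhere_affine smooth_everywhere_flat)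
  have nn: "0 \<le> \<beta> x" for x by (simp add: \<beta>_def \<eta>_def)
  have cont: "continuous_on {- \<delta>..\<delta>} \<beta>" using sm by (rule smooth_everywhere_continuous0)
  have int: "(\<beta> has_integral I) {- \<delta>..\<delta>}"
    unfolding I_def using cont by (intro integrable_integral integrable_continuous_interval)
  have "I \<noteq> 0"
  proof
    assume "I = 0"
    then have "\<beta> 0 = 0"
      using has_integral_0_cbox_imp_0[of "- \<delta>" \<delta> \<beta> 0] cont int nn \<delta> by auto
    then show False using \<delta> by (simp add: \<beta>_def \<eta>_def)
  qed
  moreover have "0 \<le> I" unfolding I_def by (rule integral_nonneg) (use int nn in auto)
  ultimately have I: "0 < I" by simp
  show thesis
  \<comment> \<open>The zero second term only gives the function the shape of
    \<open>smooth_everywhere_lincomb\<close>.\<close>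
  proof (rule that[of "\<lambda>x. 1 / I * \<beta> x + 0 * \<beta> x"])
    show "smooth_everywhere (\<lambda>x. 1 / I * \<beta> x + 0 * \<beta> x)" by (intro smooth_everywhere_lincomb sm)
    show "supported_in (\<lambda>x. 1 / I * \<beta> x + 0 * \<beta> x) (- \<delta>) \<delta>" by (auto simp: supported_in_def \<beta>_def \<eta>_def)
    show "((\<lambda>x. 1 / I * \<beta> x + 0 * \<beta> x) has_integral 1) {- \<delta>..\<delta>}"
      using has_integral_mult_right[OF int, of "1 / I"] I by simp
  qed (use I nn in auto)
qed

subsection \<open>Distributions and their mollification\<close>

text \<open>The suprema in \<open>distribution01\<close> are traded for an arbitrary common bound
  \<open>B\<close> on the derivatives, so that pointwise estimates can be inserted directly.\<close>

definition seminorm_bound :: "((real \<Rightarrow> real) \<Rightarrow> real) \<Rightarrow> real \<Rightarrow> real \<Rightarrow> nat \<Rightarrow> real \<Rightarrow> bool" where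
  "seminorm_bound U a b k C \<longleftrightarrow> (\<forall>\<phi> B. smooth_everywhere \<phi> \<longrightarrow> supported_in \<phi> a b \<longrightarrow>
     (\<forall>j\<le>k. \<forall>x. \<bar>(deriv ^^ j) \<phi> x\<bar> \<le> B) \<longrightarrow> \<bar>U \<phi>\<bar> \<le> C * B)"

lemma test_fun01I:
  "smooth_everywhere \<phi> \<Longrightarrow> supported_in \<phi> a b \<Longrightarrow> 0 < a \<Longrightarrow> a \<le> b \<Longrightarrow> b < 1 \<Longrightarrow> test_fun01 \<phi>"
  unfolding test_fun01_def by blast

lemma distribution01_seminorm_bound:
  assumes U: "distribution01 U" and ab: "0 < a" "a \<le> b" "b < 1"
  obtains k C where "0 \<le> C" "seminorm_bound U a b k C"
proof -
  obtain C k where C: "\<And>\<phi>. test_fun01 \<phi> \<Longrightarrow> supported_in \<phi> a b \<Longrightarrow>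
      \<bar>U \<phi>\<bar> \<le> C * (\<Sum>j\<le>(k::nat). (SUP x. \<bar>(deriv ^^ j) \<phi> x\<bar>))"
    using U ab unfolding distribution01_def by blast
  \<comment> \<open>The sum over j \<le> k has k + 1 terms, each at most \<open>B\<close>; the
    absolute value is taken because the sign of \<open>C\<close> is unknown.\<close>
  have "seminorm_bound U a b k (\<bar>C\<bar> * real (Suc k))"
    unfolding seminorm_bound_def
  proof (intro allI impI)
    fix \<phi> B assume \<phi>: "smooth_everywhere \<phi>" "supported_in \<phi> a b"
      and B: "\<forall>j\<le>k. \<forall>x. \<bar>(deriv ^^ j) \<phi> x\<bar> \<le> B"
    let ?s = "\<lambda>j. SUP x. \<bar>(deriv ^^ j) \<phi> x\<bar>"
    have s: "0 \<le> ?s j" "?s j \<le> B" if "j \<le> k" for j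
    proof -
      have "bdd_above (range (\<lambda>x. \<bar>(deriv ^^ j) \<phi> x\<bar>))"
        using B that by (intro bdd_aboveI[of _ B]) auto
      then have "\<bar>(deriv ^^ j) \<phi> 0\<bar> \<le> ?s j" by (rule cSUP_upper[rotated]) simp
      then show "0 \<le> ?s j" by linarith
      show "?s j \<le> B" using B that by (intro cSUP_least) auto
    qed
    have "\<bar>U \<phi>\<bar> \<le> C * (\<Sum>j\<le>k. ?s j)" using C test_fun01I \<phi> ab by blast
    also have "\<dots> \<le> \<bar>C\<bar> * (\<Sum>j\<le>k. ?s j)"
      using s by (intro mult_right_mono sum_nonneg) auto
    also have "\<dots> \<le> \<bar>C\<bar> * (\<Sum>j\<le>k. B)"
      using s by (intro mult_left_mono sum_mono) auto
    finally show "\<bar>U \<phi>\<bar> \<le> \<bar>C\<bar> * real (Suc k) * B" by simp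
  qed
  then show thesis by (intro that) auto
qed

lemma distribution01_lincomb:
  "distribution01 U \<Longrightarrow> test_fun01 \<phi> \<Longrightarrow> test_fun01 \<psi> \<Longrightarrow>
    U (\<lambda>x. c * \<phi> x + d * \<psi> x) = c * U \<phi> + d * U \<psi>"
  by (simp add: distribution01_def)

lemma smooth_everywhere_zero: "smooth_everywhere (\<lambda>x. 0)"
  by (rule smooth_everywhereI_jet[of "\<lambda>n x. 0"]) auto

lemma distribution01_zero: "distribution01 U \<Longrightarrow> U (\<lambda>x. 0) = 0"
  using distribution01_lincomb[of U "\<lambda>x. 0" "\<lambda>x. 0" 0 0]
    test_fun01I[of "\<lambda>x. 0" "1/2" "1/2", OF smooth_everywhere_zero]
  by (simp add: supported_in_def)

text \<open>Differentiation under \<open>U\<close>: the remainder \<Phi> s - \<Phi> t - (s - t)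
  \<Psi> is quadratically small together with each of its derivatives, and all supports lie in one
  compact interval, so a single seminorm estimate makes \<open>U\<close> of the remainder
  quadratically small.\<close>

lemma distribution01_has_real_derivative:
  assumes U: "distribution01 U" and ab: "0 < a" "a \<le> b" "b < 1"
    and \<Phi>: "\<And>s. s \<in> S \<Longrightarrow> smooth_everywhere (\<Phi> s)" "\<And>s. s \<in> S \<Longrightarrow> supported_in (\<Phi> s) a b"
    and \<Psi>: "smooth_everywhere \<Psi>" "supported_in \<Psi> a b" and t: "t \<in> S"
    and bd: "\<And>j. \<exists>M. \<forall>s\<in>S. \<forall>y.
      \<bar>(deriv ^^ j) (\<Phi> s) y - (deriv ^^ j) (\<Phi> t) y - (s - t) * (deriv ^^ j) \<Psi> y\<bar> \<le> M * (s - t)\<^sup>2"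
  shows "((\<lambda>s. U (\<Phi> s)) has_real_derivative U \<Psi>) (at t within S)"
proof -
  obtain k C where C: "0 \<le> C" "seminorm_bound U a b k C"
    using distribution01_seminorm_bound[OF U ab] .
  obtain M where M: "\<And>j s y. s \<in> S \<Longrightarrow>
      \<bar>(deriv ^^ j) (\<Phi> s) y - (deriv ^^ j) (\<Phi> t) y - (s - t) * (deriv ^^ j) \<Psi> y\<bar> \<le> M j * (s - t)\<^sup>2"
    using bd by metis
  \<comment> \<open>The constants may grow with the order j, but the seminorm of \<open>U\<close>
    sees only the orders up to k.\<close>
  define L where "L = (\<Sum>j\<le>k. \<bar>M j\<bar>)"
  have L: "M j \<le> L" if "j \<le> k" for j
    using member_le_sum[of j "{..k}" "\<lambda>j. \<bar>M j\<bar>"] that by (auto simp: L_def)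
  have main: "\<bar>U (\<Phi> s) - U (\<Phi> t) - (s - t) * U \<Psi>\<bar> \<le> C * (L * (s - t)\<^sup>2)" if s: "s \<in> S" for s
  proof -
    \<comment> \<open>The remainder is assembled from nested two-term combinations, the only form in
      which linearity of \<open>U\<close> is available.\<close>
    let ?A = "\<lambda>x. 1 * \<Phi> t x + (s - t) * \<Psi> x"
    let ?R = "\<lambda>x. 1 * \<Phi> s x + (- 1) * ?A x"
    have sA: "smooth_everywhere ?A" by (intro smooth_everywhere_lincomb \<Phi> \<Psi> t)
    have A: "supported_in ?A a b" using \<Phi>(2)[OF t] \<Psi>(2) by (auto simp: supported_in_def)
    have sR: "smooth_everywhere ?R" by (intro smooth_everywhere_lincomb \<Phi> \<Psi> t s sA)
    have R: "supported_in ?R a b" using A \<Phi>(2)[OF s] by (auto simp: supported_in_def)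
    have "(deriv ^^ j) ?R y = (deriv ^^ j) (\<Phi> s) y - (deriv ^^ j) (\<Phi> t) y - (s - t) * (deriv ^^ j) \<Psi> y" for j y
      unfolding smooth_everywhere_lincomb(2)[OF \<Phi>(1)[OF s] sA] smooth_everywhere_lincomb(2)[OF \<Phi>(1)[OF t] \<Psi>(1)]
      by simp
    then have "\<bar>(deriv ^^ j) ?R y\<bar> \<le> L * (s - t)\<^sup>2" if "j \<le> k" for j y
      using M[OF s, of j y] mult_right_mono[OF L[OF that], of "(s - t)\<^sup>2"] by simp
    then have "\<bar>U ?R\<bar> \<le> C * (L * (s - t)\<^sup>2)"
      using C(2) sR R unfolding seminorm_bound_def by blast
    moreover have "U ?R = 1 * U (\<Phi> s) + (- 1) * U ?A"
      using test_fun01I \<Phi> s ab sA A by (intro distribution01_lincomb[OF U]) blast+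
    moreover have "U ?A = 1 * U (\<Phi> t) + (s - t) * U \<Psi>"
      using test_fun01I \<Phi> t ab \<Psi> by (intro distribution01_lincomb[OF U]) blast+
    ultimately show ?thesis by simp
  qed
  have "((\<lambda>s. (U (\<Phi> s) - U (\<Phi> t)) / (s - t) - U \<Psi>) \<longlongrightarrow> 0) (at t within S)"
  proof (rule Lim_null_comparison)
    show "\<forall>\<^sub>F s in at t within S. norm ((U (\<Phi> s) - U (\<Phi> t)) / (s - t) - U \<Psi>) \<le> C * L * \<bar>s - t\<bar>"
      unfolding eventually_at_filter
    proof (intro always_eventually allI impI)
      fix s assume s: "s \<noteq> t" "s \<in> S"
      have sq: "(s - t)\<^sup>2 = \<bar>s - t\<bar> * \<bar>s - t\<bar>" by (simp add: power2_eq_square)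
      have "(U (\<Phi> s) - U (\<Phi> t)) / (s - t) - U \<Psi> = (U (\<Phi> s) - U (\<Phi> t) - (s - t) * U \<Psi>) / (s - t)"
        using s by (simp add: field_simps)
      then have "norm ((U (\<Phi> s) - U (\<Phi> t)) / (s - t) - U \<Psi>) \<le> C * (L * (s - t)\<^sup>2) / \<bar>s - t\<bar>"
        using main[OF s(2)] by (simp add: divide_right_mono)
      also have "\<dots> = C * L * \<bar>s - t\<bar>"
      proof -
        have *: "C * (L * (r * r)) / r = C * L * r" if "r \<noteq> 0" for r :: real using that by simp
        show ?thesis unfolding sq by (rule *) (use s in simp)
      qed
      finally show "norm ((U (\<Phi> s) - U (\<Phi> t)) / (s - t) - U \<Psi>) \<le> C * L * \<bar>s - t\<bar>" .
    qed
    show "((\<lambda>s. C * L * \<bar>s - t\<bar>) \<longlongrightarrow> 0) (at t within S)"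
      by (auto intro!: tendsto_eq_intros)
  qed
  then show ?thesis
    unfolding has_field_derivative_iff by (rule LIM_zero_cancel)
qed

text \<open>The function z \<mapsto> f z - z * f' t has derivative f' z - f' t, which is at most M
  |s - t| on the segment from t to s; the mean value inequality supplies the second factor |s -
  t|.\<close>

lemma quadratic_remainder_bound:
  fixes f f' :: "real \<Rightarrow> real"
  assumes S: "convex S" and f: "\<And>s. s \<in> S \<Longrightarrow> (f has_real_derivative f' s) (at s within S)"
    and M: "\<And>s. s \<in> S \<Longrightarrow> \<bar>f' s - f' t\<bar> \<le> M * \<bar>s - t\<bar>" and t: "t \<in> S" and s: "s \<in> S"
  shows "\<bar>f s - f t - (s - t) * f' t\<bar> \<le> M * (s - t)\<^sup>2"
proof (cases "s = t")
  case False
  let ?I = "closed_segment t s"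
  have I: "?I \<subseteq> S" using S s t by (simp add: closed_segment_subset)
  have "0 \<le> M * \<bar>s - t\<bar>" using M[OF s] by linarith
  then have Mpos: "0 \<le> M" using False by (simp add: zero_le_mult_iff)
  have "norm ((f s - s * f' t) - (f t - t * f' t)) \<le> (M * \<bar>s - t\<bar>) * norm (s - t)"
  proof (rule field_differentiable_bound[of ?I])
    fix z assume z: "z \<in> ?I"
    show "((\<lambda>z. f z - z * f' t) has_real_derivative f' z - f' t) (at z within ?I)"
      using has_field_derivative_subset[OF f I, of z] z I by (auto intro!: derivative_eq_intros)
    have "\<bar>z - t\<bar> \<le> \<bar>s - t\<bar>" using z by (auto simp: closed_segment_eq_real_ivl split: if_splits)
    then show "norm (f' z - f' t) \<le> M * \<bar>s - t\<bar>"
      using M[of z] z I mult_left_mono[OF _ Mpos, of "\<bar>z - t\<bar>" "\<bar>s - t\<bar>"] by auto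
  qed auto
  moreover have "(f s - s * f' t) - (f t - t * f' t) = f s - f t - (s - t) * f' t"
    by (simp add: algebra_simps)
  moreover have "(M * \<bar>s - t\<bar>) * norm (s - t) = M * (s - t)\<^sup>2"
  proof -
    have "(s - t)\<^sup>2 = \<bar>s - t\<bar> * \<bar>s - t\<bar>" by (simp add: power2_eq_square)
    then show ?thesis by (simp only: real_norm_def mult.assoc)
  qed
  ultimately show ?thesis by (simp only: real_norm_def)
qed simp

lemma smooth_everywhere_lipschitz:
  assumes f: "smooth_everywhere f" and B: "\<And>x. \<bar>(deriv ^^ Suc n) f x\<bar> \<le> B"
  shows "\<bar>(deriv ^^ n) f x - (deriv ^^ n) f y\<bar> \<le> B * \<bar>x - y\<bar>"
  using field_differentiable_bound[of UNIV "(deriv ^^ n) f" "(deriv ^^ Suc n) f" B x y]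
    smooth_everywhere_DERIV[OF f, of n] B by simp

text \<open>A kernel of radius \<delta> centred at distance 2 \<delta> from the endpoints keeps a
  margin \<delta>, so all translates share one compact support and one seminorm estimate.\<close>

lemma supported_in_reflect:
  "supported_in \<rho> (- \<delta>) \<delta> \<Longrightarrow> z \<in> {2 * \<delta>..1 - 2 * \<delta>} \<Longrightarrow> supported_in (\<lambda>y. \<rho> (- 1 * y + z)) \<delta> (1 - \<delta>)"
  by (auto simp: supported_in_def)

text \<open>The function is the convolution of \<open>U\<close> with \<rho>. Continuity follows from
  differentiability in x, where the derivative falls on the kernel.\<close>

lemma distribution01_translate_continuous:
  assumes U: "distribution01 U" and \<rho>: "smooth_everywhere \<rho>" "supported_in \<rho> (- \<delta>) \<delta>"
    and \<delta>: "0 < \<delta>" "\<delta> < 1 / 4"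
  shows "continuous_on {2 * \<delta>..1 - 2 * \<delta>} (\<lambda>x. U (\<lambda>y. \<rho> (- 1 * y + x)))"
proof -
  have "((\<lambda>x. U (\<lambda>y. \<rho> (- 1 * y + x))) has_real_derivative U (\<lambda>y. deriv \<rho> (- 1 * y + t)))
      (at t within {2 * \<delta>..1 - 2 * \<delta>})" if t: "t \<in> {2 * \<delta>..1 - 2 * \<delta>}" for t
  proof (rule distribution01_has_real_derivative[OF U, of \<delta> "1 - \<delta>"])
    have d: "smooth_everywhere (deriv \<rho>)" "supported_in (deriv \<rho>) (- \<delta>) \<delta>"
      using smooth_everywhere_deriv \<rho> supported_in_derivs[OF \<rho>(2), of 1] by auto
    show "smooth_everywhere (\<lambda>y. \<rho> (- 1 * y + s))" for s using \<rho> by (intro smooth_everywhere_affine)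
    show "smooth_everywhere (\<lambda>y. deriv \<rho> (- 1 * y + t))" using d by (intro smooth_everywhere_affine)
    show "supported_in (\<lambda>y. \<rho> (- 1 * y + s)) \<delta> (1 - \<delta>)" if "s \<in> {2 * \<delta>..1 - 2 * \<delta>}" for s
      by (rule supported_in_reflect[OF \<rho>(2) that])
    show "supported_in (\<lambda>y. deriv \<rho> (- 1 * y + t)) \<delta> (1 - \<delta>)"
      by (rule supported_in_reflect[OF d(2) t])
    fix j
    obtain M where M: "\<And>x. \<bar>(deriv ^^ Suc (Suc j)) \<rho> x\<bar> \<le> M"
      using supported_in_bounded[OF \<rho>] by metis
    have "\<bar>(deriv ^^ j) (\<lambda>y. \<rho> (- 1 * y + s)) y - (deriv ^^ j) (\<lambda>y. \<rho> (- 1 * y + t)) y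
        - (s - t) * (deriv ^^ j) (\<lambda>y. deriv \<rho> (- 1 * y + t)) y\<bar> \<le> M * (s - t)\<^sup>2" for s y
    proof -
      have "\<bar>(deriv ^^ j) \<rho> (- 1 * y + s) - (deriv ^^ j) \<rho> (- 1 * y + t) - (s - t) * (deriv ^^ Suc j) \<rho> (- 1 * y + t)\<bar>
          \<le> M * (s - t)\<^sup>2"
      proof (rule quadratic_remainder_bound[of UNIV "\<lambda>s. (deriv ^^ j) \<rho> (- 1 * y + s)" "\<lambda>s. (deriv ^^ Suc j) \<rho> (- 1 * y + s)"])
        show "((\<lambda>s. (deriv ^^ j) \<rho> (- 1 * y + s)) has_real_derivative (deriv ^^ Suc j) \<rho> (- 1 * y + s)) (at s)" for s
        proof -
          have "((\<lambda>s. (deriv ^^ j) \<rho> (- 1 * y + s)) has_real_derivative (deriv ^^ Suc j) \<rho> (- 1 * y + s) * 1) (at s)"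
            by (rule DERIV_chain2[OF smooth_everywhere_DERIV[OF \<rho>(1)]]) (auto intro!: derivative_eq_intros)
          then show ?thesis by (simp only: mult_1_right)
        qed
        show "\<bar>(deriv ^^ Suc j) \<rho> (- 1 * y + s) - (deriv ^^ Suc j) \<rho> (- 1 * y + t)\<bar> \<le> M * \<bar>s - t\<bar>" for s
          using smooth_everywhere_lipschitz[OF \<rho>(1) M, of "- 1 * y + s" "- 1 * y + t"] by simp
      qed auto
      \<comment> \<open>Each derivative in y brings a sign from the reflection; the common factor
        (-1)^j disappears under the absolute value.\<close>
      moreover have "(deriv ^^ j) (\<lambda>y. \<rho> (- 1 * y + s)) y - (deriv ^^ j) (\<lambda>y. \<rho> (- 1 * y + t)) y
        - (s - t) * (deriv ^^ j) (\<lambda>y. deriv \<rho> (- 1 * y + t)) y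
        = (- 1) ^ j * ((deriv ^^ j) \<rho> (- 1 * y + s) - (deriv ^^ j) \<rho> (- 1 * y + t) - (s - t) * (deriv ^^ Suc j) \<rho> (- 1 * y + t))"
        unfolding smooth_everywhere_affine(2)[OF \<rho>(1)] smooth_everywhere_affine(2)[OF d(1)]
          funpow_Suc_right o_apply by (simp add: algebra_simps)
      ultimately show ?thesis by (simp add: abs_mult power_abs)
    qed
    then show "\<exists>M. \<forall>s\<in>{2 * \<delta>..1 - 2 * \<delta>}. \<forall>y. \<bar>(deriv ^^ j) (\<lambda>y. \<rho> (- 1 * y + s)) y
        - (deriv ^^ j) (\<lambda>y. \<rho> (- 1 * y + t)) y - (s - t) * (deriv ^^ j) (\<lambda>y. deriv \<rho> (- 1 * y + t)) y\<bar> \<le> M * (s - t)\<^sup>2"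
      by blast
  qed (use \<delta> t in auto)
  then show ?thesis by (rule DERIV_continuous_on)
qed

text \<open>Reflections are written as - 1 * y + x to match the affine substitution lemma.\<close>
definition mollify :: "(real \<Rightarrow> real) \<Rightarrow> (real \<Rightarrow> real) \<Rightarrow> real \<Rightarrow> real \<Rightarrow> real" where
  "mollify \<rho> \<phi> t y = integral {0..t} (\<lambda>x. \<phi> x * \<rho> (- 1 * y + x))"

section \<open>Mollified test functions\<close>

lemma smooth_shift_continuous:
  "smooth_everywhere f \<Longrightarrow> continuous_on A (\<lambda>x. (deriv ^^ n) f (- 1 * y + x))"
  by (rule continuous_on_compose2[OF smooth_everywhere_continuous[of f UNIV n]]) (auto intro!: continuous_intros)

lemma smooth_shift_continuous0:
  "smooth_everywhere f \<Longrightarrow> continuous_on A (\<lambda>x. f (- 1 * y + x))"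
  using smooth_shift_continuous[of f A 0 y] by simp

text \<open>Differentiation under the integral sign; the alternating sign comes from the reflected
  argument. The form with general n makes the integrals a sequence of successive
  derivatives.\<close>

lemma mollify_kernel_deriv:
  assumes \<rho>: "smooth_everywhere \<rho>" and \<phi>: "continuous_on UNIV \<phi>"
  shows "((\<lambda>y. integral {0..t} (\<lambda>x. \<phi> x * ((- 1) ^ n * (deriv ^^ n) \<rho> (- 1 * y + x)))) has_real_derivative
     integral {0..t} (\<lambda>x. \<phi> x * ((- 1) ^ Suc n * (deriv ^^ Suc n) \<rho> (- 1 * y + x)))) (at y)"
proof -
  let ?g = "\<lambda>n y x. \<phi> x * ((- 1) ^ n * (deriv ^^ n) \<rho> (- 1 * y + x))"
  have "((\<lambda>y. integral (cbox 0 t) (?g n y)) has_real_derivative integral (cbox 0 t) (?g (Suc n) y)) (at y within UNIV)"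
  proof (rule leibniz_rule_field_derivative)
    fix y x :: real
    have "((\<lambda>y. (deriv ^^ n) \<rho> (- 1 * y + x)) has_real_derivative (deriv ^^ Suc n) \<rho> (- 1 * y + x) * - 1) (at y)"
      by (rule DERIV_chain2[OF smooth_everywhere_DERIV[OF \<rho>]]) (auto intro!: derivative_eq_intros)
    then have "((\<lambda>y. \<phi> x * ((- 1) ^ n * (deriv ^^ n) \<rho> (- 1 * y + x))) has_real_derivative
        \<phi> x * ((- 1) ^ n * ((deriv ^^ Suc n) \<rho> (- 1 * y + x) * - 1))) (at y)"
      by (intro DERIV_cmult)
    then show "((\<lambda>y. ?g n y x) has_real_derivative ?g (Suc n) y x) (at y within UNIV)" by simp
  next
    fix y :: real
    have "continuous_on {0..t} (?g n y)"
      by (intro continuous_intros smooth_shift_continuous \<rho> continuous_on_subset[OF \<phi>]) auto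
    then show "?g n y integrable_on cbox 0 t" by (simp add: integrable_continuous_interval)
  next
    have "continuous_on (UNIV \<times> cbox 0 t) (\<lambda>z. \<phi> (snd z))"
      by (rule continuous_on_compose2[OF \<phi>]) (auto intro!: continuous_intros)
    moreover have "continuous_on (UNIV \<times> cbox 0 t) (\<lambda>z. (deriv ^^ Suc n) \<rho> (- 1 * fst z + snd z))"
      by (rule continuous_on_compose2[OF smooth_everywhere_continuous[OF \<rho>, of UNIV "Suc n"]]) (auto intro!: continuous_intros)
    ultimately have "continuous_on (UNIV \<times> cbox 0 t)
        (\<lambda>z. \<phi> (snd z) * ((- 1) ^ Suc n * (deriv ^^ Suc n) \<rho> (- 1 * fst z + snd z)))"
      by (intro continuous_intros)
    then show "continuous_on (UNIV \<times> cbox 0 t) (\<lambda>(y, x). ?g (Suc n) y x)"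
      by (simp only: case_prod_unfold)
  qed auto
  then show ?thesis by simp
qed

lemma mollify_smooth:
  assumes \<rho>: "smooth_everywhere \<rho>" and \<phi>: "continuous_on UNIV \<phi>"
  shows "smooth_everywhere (mollify \<rho> \<phi> t)"
    and "(deriv ^^ n) (mollify \<rho> \<phi> t) = (\<lambda>y. integral {0..t} (\<lambda>x. \<phi> x * ((- 1) ^ n * (deriv ^^ n) \<rho> (- 1 * y + x))))"
proof -
  let ?F = "\<lambda>n y. integral {0..t} (\<lambda>x. \<phi> x * ((- 1) ^ n * (deriv ^^ n) \<rho> (- 1 * y + x)))"
  have "?F 0 = mollify \<rho> \<phi> t" by (simp add: mollify_def[abs_def])
  then show "smooth_everywhere (mollify \<rho> \<phi> t)" "(deriv ^^ n) (mollify \<rho> \<phi> t) = ?F n"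
    using smooth_everywhereI_jet[of ?F] mollify_kernel_deriv[OF assms] by auto
qed

lemma mollify_supported:
  assumes "supported_in \<rho> (- \<delta>) \<delta>" "supported_in \<phi> a b"
  shows "supported_in (mollify \<rho> \<phi> t) (a - \<delta>) (b + \<delta>)"
proof -
  have "mollify \<rho> \<phi> t y = 0" if y: "y \<notin> {a - \<delta>..b + \<delta>}" for y
    unfolding mollify_def
  proof (rule integral_unique[OF has_integral_is_0])
    show "\<phi> x * \<rho> (- 1 * y + x) = 0" for x
      using assms y unfolding supported_in_def by (cases "x \<in> {a..b}") auto
  qed
  then show ?thesis by (simp add: supported_in_def)
qed

text \<open>Integration by parts moves the derivatives onto the test function.\<close>
lemma mollify_derivs:
  assumes \<rho>: "smooth_everywhere \<rho>" and \<phi>: "smooth_everywhere \<phi>" "supported_in \<phi> a b" and ab: "0 < a" "b < 1"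
  shows "(deriv ^^ n) (mollify \<rho> \<phi> 1) = (\<lambda>y. integral {0..1} (\<lambda>x. (deriv ^^ n) \<phi> x * \<rho> (- 1 * y + x)))"
proof -
  let ?F = "\<lambda>n y. integral {0..1} (\<lambda>x. (deriv ^^ n) \<phi> x * \<rho> (- 1 * y + x))"
  have "(?F n has_real_derivative ?F (Suc n) y) (at y)" for n y
  proof -
    let ?A = "\<lambda>x. (deriv ^^ n) \<phi> x * deriv \<rho> (- 1 * y + x)"
    let ?B = "\<lambda>x. (deriv ^^ Suc n) \<phi> x * \<rho> (- 1 * y + x)"
    have z: "(deriv ^^ n) \<phi> 0 = 0" "(deriv ^^ n) \<phi> 1 = 0"
      using supported_in_derivs[OF \<phi>(2), of n] ab by (auto simp: supported_in_def)
    have cA: "continuous_on {0..1} ?A"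
      using smooth_shift_continuous[OF \<rho>, of _ 1 y]
      by (intro continuous_intros smooth_everywhere_continuous \<phi>) simp
    have cB: "continuous_on {0..1} ?B"
      by (intro continuous_intros smooth_everywhere_continuous smooth_shift_continuous0 \<phi> \<rho>)
    have "((\<lambda>x. ?B x + ?A x) has_integral
        (deriv ^^ n) \<phi> 1 * \<rho> (- 1 * y + 1) - (deriv ^^ n) \<phi> 0 * \<rho> (- 1 * y + 0)) {0..1}"
    proof (rule fundamental_theorem_of_calculus)
      fix x :: real
      have "((\<lambda>x. \<rho> (- 1 * y + x)) has_real_derivative deriv \<rho> (- 1 * y + x) * 1) (at x)"
        by (rule DERIV_chain2[OF smooth_everywhere_DERIV[OF \<rho>, of 0, simplified]]) (auto intro!: derivative_eq_intros)
      then have "((\<lambda>x. (deriv ^^ n) \<phi> x * \<rho> (- 1 * y + x)) has_real_derivative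
          ?B x + deriv \<rho> (- 1 * y + x) * 1 * (deriv ^^ n) \<phi> x) (at x)"
        by (intro DERIV_mult smooth_everywhere_DERIV \<phi>)
      then show "((\<lambda>x. (deriv ^^ n) \<phi> x * \<rho> (- 1 * y + x)) has_vector_derivative ?B x + ?A x) (at x within {0..1})"
        by (simp add: has_real_derivative_iff_has_vector_derivative[symmetric] has_field_derivative_at_within mult.commute)
    qed simp
    then have "integral {0..1} ?B + integral {0..1} ?A = 0"
      using z integral_add[of ?B "{0..1}" ?A] integrable_continuous_interval[OF cA] integrable_continuous_interval[OF cB]
      by (simp add: integral_unique)
    moreover have "((\<lambda>y. integral {0..1} (\<lambda>x. (deriv ^^ n) \<phi> x * \<rho> (- 1 * y + x))) has_real_derivative - integral {0..1} ?A) (at y)"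
      using mollify_kernel_deriv[OF \<rho> smooth_everywhere_continuous[OF \<phi>(1)], of 1 n 0 y] by simp
    ultimately show ?thesis by (simp add: add_eq_0_iff2)
  qed
  moreover have "?F 0 = mollify \<rho> \<phi> 1" by (simp add: mollify_def[abs_def])
  ultimately show ?thesis using smooth_everywhereI_jet(2)[of ?F] by auto
qed

text \<open>For y in [a - \<delta>, b + \<delta>] the translated kernel has its full mass 1 inside
  [0,1], so the difference is an average of f x - f y over |x - y| \<le> \<delta>, where f is the
  n-th derivative; the mean value inequality bounds it. For other y both terms vanish.\<close>

lemma mollify_close:
  assumes \<rho>: "smooth_everywhere \<rho>" "supported_in \<rho> (- \<delta>) \<delta>" "\<And>x. 0 \<le> \<rho> x" "(\<rho> has_integral 1) {- \<delta>..\<delta>}"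
    and \<phi>: "smooth_everywhere \<phi>" "supported_in \<phi> a b" and ab: "2 * \<delta> \<le> a" "b \<le> 1 - 2 * \<delta>" and \<delta>: "0 < \<delta>"
    and B: "\<And>x. \<bar>(deriv ^^ Suc n) \<phi> x\<bar> \<le> B"
  shows "\<bar>(deriv ^^ n) (mollify \<rho> \<phi> 1) y - (deriv ^^ n) \<phi> y\<bar> \<le> \<delta> * B"
proof (cases "y \<in> {a - \<delta>..b + \<delta>}")
  case False
  have "(deriv ^^ n) (mollify \<rho> \<phi> 1) y = 0" "(deriv ^^ n) \<phi> y = 0"
    using False supported_in_derivs[OF mollify_supported[OF \<rho>(2) \<phi>(2)], of n] supported_in_derivs[OF \<phi>(2), of n] \<delta>
    by (auto simp: supported_in_def)
  moreover have "0 \<le> B" using B[of 0] by linarith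
  ultimately show ?thesis using \<delta> by simp
next
  case True
  let ?f = "(deriv ^^ n) \<phi>"
  have one: "((\<lambda>x. \<rho> (- 1 * y + x)) has_integral 1) {0..1}"
  proof -
    have "(\<rho> has_integral 1) {0 + - y..1 + - y}"
      by (rule has_integral_on_superset[OF \<rho>(4)]) (use \<rho>(2) True ab \<delta> in \<open>auto simp: supported_in_def\<close>)
    then show ?thesis using has_integral_shift_Icc_real[of \<rho> "- y" 1 0 1] by (simp add: o_def)
  qed
  have cf: "continuous_on {0..1} (\<lambda>x. ?f x * \<rho> (- 1 * y + x))"
    by (intro continuous_intros smooth_everywhere_continuous smooth_shift_continuous0 \<phi> \<rho>)
  have h1: "((\<lambda>x. ?f x * \<rho> (- 1 * y + x) - ?f y * \<rho> (- 1 * y + x)) has_integral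
      (deriv ^^ n) (mollify \<rho> \<phi> 1) y - ?f y * 1) {0..1}"
  proof (intro has_integral_diff has_integral_mult_right[OF one])
    have "(deriv ^^ n) (mollify \<rho> \<phi> 1) y = integral {0..1} (\<lambda>x. ?f x * \<rho> (- 1 * y + x))"
      using mollify_derivs[OF \<rho>(1) \<phi>, of n] ab \<delta> by simp
    then show "((\<lambda>x. ?f x * \<rho> (- 1 * y + x)) has_integral (deriv ^^ n) (mollify \<rho> \<phi> 1) y) {0..1}"
      using integrable_integral[OF integrable_continuous_interval[OF cf]] by simp
  qed
  have h2: "((\<lambda>x. \<delta> * B * \<rho> (- 1 * y + x)) has_integral \<delta> * B * 1) {0..1}"
    by (rule has_integral_mult_right[OF one])
  have h3: "norm (?f x * \<rho> (- 1 * y + x) - ?f y * \<rho> (- 1 * y + x)) \<le> \<delta> * B * \<rho> (- 1 * y + x)" for x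
  proof (cases "x - y \<in> {- \<delta>..\<delta>}")
    case True
    have "0 \<le> B" using B[of 0] by linarith
    then have "\<bar>?f x - ?f y\<bar> \<le> \<delta> * B"
      using smooth_everywhere_lipschitz[OF \<phi>(1) B, of x y] mult_left_mono[of "\<bar>x - y\<bar>" \<delta> B] True
      by (simp add: mult.commute) linarith
    then have "\<bar>?f x - ?f y\<bar> * \<rho> (- 1 * y + x) \<le> \<delta> * B * \<rho> (- 1 * y + x)"
      using \<rho>(3) by (intro mult_right_mono)
    moreover have "norm (?f x * \<rho> (- 1 * y + x) - ?f y * \<rho> (- 1 * y + x)) = \<bar>?f x - ?f y\<bar> * \<rho> (- 1 * y + x)"
      using \<rho>(3) by (simp add: abs_mult flip: left_diff_distrib)
    ultimately show ?thesis by simp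
  next
    case False
    then have "\<rho> (- 1 * y + x) = 0" using \<rho>(2) by (auto simp: supported_in_def)
    then show ?thesis by simp
  qed
  have "norm (integral {0..1} (\<lambda>x. ?f x * \<rho> (- 1 * y + x) - ?f y * \<rho> (- 1 * y + x)))
      \<le> integral {0..1} (\<lambda>x. \<delta> * B * \<rho> (- 1 * y + x))"
    by (rule integral_norm_bound_integral[OF has_integral_integrable[OF h1] has_integral_integrable[OF h2] h3])
  then show ?thesis unfolding integral_unique[OF h1] integral_unique[OF h2] by simp
qed

lemma abs_mult_diff_le:
  fixes a b c d :: real
  assumes "\<bar>a\<bar> \<le> A" "\<bar>d\<bar> \<le> D" "\<bar>b - d\<bar> \<le> X" "\<bar>a - c\<bar> \<le> Y"
  shows "\<bar>a * b - c * d\<bar> \<le> A * X + D * Y"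
proof -
  have "a * b - c * d = a * (b - d) + d * (a - c)" by (simp add: algebra_simps)
  moreover have "\<bar>a * (b - d)\<bar> \<le> A * X" "\<bar>d * (a - c)\<bar> \<le> D * Y"
    using assms by (auto simp: abs_mult intro!: mult_mono)
  ultimately show ?thesis by linarith
qed

text \<open>Both sides, as functions of the upper limit of integration, vanish at 0 and have the same
  derivative; this replaces an interchange of U with the integral.\<close>
lemma distribution01_mollify:
  assumes U: "distribution01 U" and \<rho>: "smooth_everywhere \<rho>" "supported_in \<rho> (- \<delta>) \<delta>"
    and \<phi>: "smooth_everywhere \<phi>" "supported_in \<phi> a b" and ab: "2 * \<delta> \<le> a" "b \<le> 1 - 2 * \<delta>"
    and \<delta>: "0 < \<delta>" "\<delta> < 1 / 4"
  shows "((\<lambda>x. \<phi> x * U (\<lambda>y. \<rho> (- 1 * y + max (2 * \<delta>) (min (1 - 2 * \<delta>) x)))) has_integral U (mollify \<rho> \<phi> 1)) {0..1}"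
proof -
  \<comment> \<open>Clamping keeps the translated kernel a test function on (0,1) for every x. Where
    it changes x, \<phi> vanishes.\<close>
  let ?c = "\<lambda>x. max (2 * \<delta>) (min (1 - 2 * \<delta>) x)"
  have c: "?c x \<in> {2 * \<delta>..1 - 2 * \<delta>}" for x using \<delta> by auto
  have test: "test_fun01 (\<lambda>y. \<rho> (- 1 * y + ?c x))" for x
  proof (rule test_fun01I[of _ \<delta> "1 - \<delta>"])
    show "supported_in (\<lambda>y. \<rho> (- 1 * y + ?c x)) \<delta> (1 - \<delta>)"
      by (rule supported_in_reflect[OF \<rho>(2) c])
  qed (use \<delta> smooth_everywhere_affine(1)[OF \<rho>(1), of "- 1"] in auto)
  have "((\<lambda>t. U (mollify \<rho> \<phi> t)) has_real_derivative \<phi> t * U (\<lambda>y. \<rho> (- 1 * y + ?c t))) (at t within {0..1})"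
    if t: "t \<in> {0..1}" for t
  proof -
    \<comment> \<open>By the fundamental theorem of calculus this is the t-derivative of
      \<open>mollify \<rho> \<phi> t\<close>, written as a two-term combination.\<close>
    let ?\<Psi> = "\<lambda>y. \<phi> t * \<rho> (- 1 * y + ?c t) + 0 * \<rho> (- 1 * y + ?c t)"
    have s\<Psi>: "smooth_everywhere ?\<Psi>" using \<rho> by (intro smooth_everywhere_lincomb smooth_everywhere_affine)
    have "((\<lambda>t. U (mollify \<rho> \<phi> t)) has_real_derivative U ?\<Psi>) (at t within {0..1})"
    proof (rule distribution01_has_real_derivative[OF U, of \<delta> "1 - \<delta>"])
      show "smooth_everywhere (mollify \<rho> \<phi> s)" for s
        by (intro mollify_smooth \<rho> smooth_everywhere_continuous0 \<phi>)
      show "supported_in (mollify \<rho> \<phi> s) \<delta> (1 - \<delta>)" for s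
        by (rule supported_in_mono[OF mollify_supported[OF \<rho>(2) \<phi>(2)]]) (use ab in auto)
      show "supported_in ?\<Psi> \<delta> (1 - \<delta>)"
        using supported_in_reflect[OF \<rho>(2) c, of t] by (simp add: supported_in_def)
      fix j
      let ?r = "\<lambda>y x. (- 1) ^ j * (deriv ^^ j) \<rho> (- 1 * y + x)"
      obtain B0 where B0: "0 \<le> B0" "\<And>x. \<bar>\<phi> x\<bar> \<le> B0"
        using supported_in_bounded[OF \<phi>, of 0] by auto
      obtain B1 where B1: "\<And>x. \<bar>(deriv ^^ Suc 0) \<phi> x\<bar> \<le> B1"
        using supported_in_bounded[OF \<phi>] by metis
      obtain R0 where R0: "0 \<le> R0" "\<And>x. \<bar>(deriv ^^ j) \<rho> x\<bar> \<le> R0"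
        using supported_in_bounded[OF \<rho>] by metis
      obtain R1 where R1: "\<And>x. \<bar>(deriv ^^ Suc j) \<rho> x\<bar> \<le> R1"
        using supported_in_bounded[OF \<rho>] by metis
      \<comment> \<open>The product-rule Lipschitz constant of x \<mapsto> \<phi> x * ?r y x,
        uniform in y.\<close>
      let ?M = "B0 * R1 + R0 * B1"
      have \<Psi>j: "(deriv ^^ j) ?\<Psi> y = \<phi> t * ?r y t" for y
      proof (cases "t \<in> {2 * \<delta>..1 - 2 * \<delta>}")
        case True
        then have "?c t = t" by auto
        then show ?thesis
          unfolding smooth_everywhere_lincomb(2)[OF smooth_everywhere_affine(1)[OF \<rho>(1)] smooth_everywhere_affine(1)[OF \<rho>(1)]]
            smooth_everywhere_affine(2)[OF \<rho>(1)] by simp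
      next
        case False
        then have "\<phi> t = 0" using \<phi>(2) ab by (auto simp: supported_in_def)
        then show ?thesis
          unfolding smooth_everywhere_lincomb(2)[OF smooth_everywhere_affine(1)[OF \<rho>(1)] smooth_everywhere_affine(1)[OF \<rho>(1)]]
          by simp
      qed
      have "\<bar>(deriv ^^ j) (mollify \<rho> \<phi> s) y - (deriv ^^ j) (mollify \<rho> \<phi> t) y - (s - t) * (deriv ^^ j) ?\<Psi> y\<bar>
          \<le> ?M * (s - t)\<^sup>2" if s: "s \<in> {0..1}" for s y
        unfolding mollify_smooth(2)[OF \<rho>(1) smooth_everywhere_continuous0[OF \<phi>(1)]] \<Psi>j
      proof (rule quadratic_remainder_bound[where S = "{0..1}" and f' = "\<lambda>x. \<phi> x * ?r y x"])
        show "((\<lambda>s. integral {0..s} (\<lambda>x. \<phi> x * ?r y x)) has_real_derivative \<phi> s * ?r y s) (at s within {0..1})"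
          if "s \<in> {0..1}" for s
          using that by (intro integral_has_real_derivative continuous_intros smooth_everywhere_continuous0
              smooth_shift_continuous \<phi> \<rho>)
        show "\<bar>\<phi> s * ?r y s - \<phi> t * ?r y t\<bar> \<le> ?M * \<bar>s - t\<bar>" for s
        proof -
          have r: "\<bar>?r y s - ?r y t\<bar> \<le> R1 * \<bar>s - t\<bar>"
            using smooth_everywhere_lipschitz[OF \<rho>(1) R1, of "- 1 * y + s" "- 1 * y + t"]
            by (simp add: abs_mult power_abs flip: right_diff_distrib)
          have p: "\<bar>\<phi> s - \<phi> t\<bar> \<le> B1 * \<bar>s - t\<bar>"
            using smooth_everywhere_lipschitz[OF \<phi>(1) B1, of s t] by simp
          have r0: "\<bar>?r y t\<bar> \<le> R0" using R0(2) by (simp add: abs_mult power_abs)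
          have "\<bar>\<phi> s * ?r y s - \<phi> t * ?r y t\<bar> \<le> B0 * (R1 * \<bar>s - t\<bar>) + R0 * (B1 * \<bar>s - t\<bar>)"
            by (rule abs_mult_diff_le[OF B0(2) r0 r p])
          then show ?thesis by (simp only: distrib_right mult.assoc)
        qed
      qed (use s t in auto)
      then show "\<exists>M. \<forall>s\<in>{0..1}. \<forall>y. \<bar>(deriv ^^ j) (mollify \<rho> \<phi> s) y - (deriv ^^ j) (mollify \<rho> \<phi> t) y
          - (s - t) * (deriv ^^ j) ?\<Psi> y\<bar> \<le> M * (s - t)\<^sup>2" by blast
    qed (use \<delta> t s\<Psi> in auto)
    moreover have "U ?\<Psi> = \<phi> t * U (\<lambda>y. \<rho> (- 1 * y + ?c t)) + 0 * U (\<lambda>y. \<rho> (- 1 * y + ?c t))"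
      by (rule distribution01_lincomb[OF U test test])
    ultimately show ?thesis by simp
  qed
  then have "((\<lambda>x. \<phi> x * U (\<lambda>y. \<rho> (- 1 * y + ?c x))) has_integral
      U (mollify \<rho> \<phi> 1) - U (mollify \<rho> \<phi> 0)) {0..1}"
    by (intro fundamental_theorem_of_calculus) (auto simp: has_real_derivative_iff_has_vector_derivative)
  moreover have "mollify \<rho> \<phi> 0 = (\<lambda>y. 0)" by (simp add: mollify_def[abs_def])
  ultimately show ?thesis by (simp add: distribution01_zero[OF U])
qed

subsection \<open>Approximation by sine sums\<close>

definition sine_poly :: "(real \<Rightarrow> real) \<Rightarrow> bool" where
  "sine_poly f \<longleftrightarrow> (\<exists>a M. sinp a M f)"

lemma sine_poly_add:
  assumes "sine_poly f" "sine_poly g" shows "sine_poly (\<lambda>x. f x + g x)"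
proof -
  obtain a M b N where "sinp a M f" "sinp b N g" using assms by (auto simp: sine_poly_def)
  then have "sinp (max a b) M f" "sinp (max a b) N g" by (auto intro: sinp_mono)
  then show ?thesis unfolding sine_poly_def by (blast intro: sinp.add)
qed

lemma sine_poly_mult_cos:
  assumes "sine_poly f" shows "sine_poly (\<lambda>x. f x * cos (pi * x))"
proof -
  obtain a M where "sinp a M f" using assms by (auto simp: sine_poly_def)
  then show ?thesis
  proof (induction rule: sinp.induct)
    case (basis k c M)
    let ?a = "\<bar>of_int (k + 1) * pi\<bar> + \<bar>of_int (k - 1) * pi\<bar> :: real"
    have "sinp ?a (\<bar>c / 2\<bar> + \<bar>c / 2\<bar>)
      (\<lambda>x. c / 2 * sin (of_int (k + 1) * pi * x) + c / 2 * sin (of_int (k - 1) * pi * x))"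
      by (intro sinp.add sinp.basis) auto
    moreover have "c / 2 * sin (of_int (k + 1) * pi * x) + c / 2 * sin (of_int (k - 1) * pi * x)
        = c * sin (of_int k * pi * x) * cos (pi * x)" for x
      by (simp add: sin_add sin_diff ring_distribs)
    ultimately show ?case by (auto simp: sine_poly_def)
  next
    case (add M f N g)
    show ?case using sine_poly_add[OF add.IH] by (simp add: algebra_simps)
  qed
qed

text \<open>Defining the algebra by its action on sine sums makes closure under products immediate
  and avoids formal polynomials in cos (pi x).\<close>

definition sine_multiplier :: "(real \<Rightarrow> real) \<Rightarrow> bool" where
  "sine_multiplier k \<longleftrightarrow> continuous_on UNIV k \<and> (\<forall>f. sine_poly f \<longrightarrow> sine_poly (\<lambda>x. f x * k x))"

lemma sine_multiplierD:
  assumes "sine_multiplier k"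
  shows "continuous_on A k" and "sine_poly f \<Longrightarrow> sine_poly (\<lambda>x. f x * k x)"
  using assms by (auto simp: sine_multiplier_def intro: continuous_on_subset)

text \<open>Stone-Weierstrass applies to the sine multipliers: they contain cos (pi x), which is
  injective on [0,1] and so separates points. Multiplying by sin (pi x) turns a multiplier into a
  sine sum and does not enlarge the error.\<close>

lemma sinp_uniform_approx:
  assumes h: "continuous_on {0..1} h" and e: "0 < e"
  obtains a M g where "sinp a M g" "\<And>x. x \<in> {0..1} \<Longrightarrow> \<bar>g x - sin (pi * x) * h x\<bar> \<le> e"
proof -
  have "\<exists>k. sine_multiplier k \<and> (\<forall>x\<in>{0..1}. \<bar>h x - k x\<bar> < e)"
  proof (rule Stone_Weierstrass_HOL)
    show "sine_multiplier (\<lambda>x. c)" for c :: real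
      unfolding sine_multiplier_def
    proof (intro conjI allI impI)
      show "sine_poly (\<lambda>x. f x * c)" if "sine_poly f" for f
        using that sinp_scale[of _ _ f c] by (auto simp: sine_poly_def mult.commute)
    qed auto
    show "sine_multiplier (\<lambda>x. f x + g x)" if "sine_multiplier f \<and> sine_multiplier g" for f g
    proof -
      have f: "sine_multiplier f" and g: "sine_multiplier g" using that by auto
      have "sine_poly (\<lambda>x. k x * (f x + g x))" if "sine_poly k" for k
        using sine_poly_add[OF sine_multiplierD(2)[OF f that] sine_multiplierD(2)[OF g that]]
        by (simp add: algebra_simps)
      then show ?thesis
        using f g by (auto simp: sine_multiplier_def intro!: continuous_intros)
    qed
    show "sine_multiplier (\<lambda>x. f x * g x)" if "sine_multiplier f \<and> sine_multiplier g" for f g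
    proof -
      have f: "sine_multiplier f" and g: "sine_multiplier g" using that by auto
      have "sine_poly (\<lambda>x. k x * (f x * g x))" if "sine_poly k" for k
        using sine_multiplierD(2)[OF g sine_multiplierD(2)[OF f that]] by (simp add: mult.assoc)
      then show ?thesis
        using f g by (auto simp: sine_multiplier_def intro!: continuous_intros)
    qed
    show "\<exists>f. sine_multiplier f \<and> f x \<noteq> f y" if xy: "x \<in> {0..1} \<and> y \<in> {0..1} \<and> x \<noteq> y" for x y
    proof (intro exI[of _ "\<lambda>x. cos (pi * x)"] conjI)
      show "sine_multiplier (\<lambda>x. cos (pi * x))"
        by (auto simp: sine_multiplier_def intro!: continuous_intros sine_poly_mult_cos)
      have "pi * x \<le> pi * 1" "pi * y \<le> pi * 1" using xy by (intro mult_left_mono; simp)+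
      then show "cos (pi * x) \<noteq> cos (pi * y)"
        using xy cos_inj_pi[of "pi * x" "pi * y"] by auto
    qed
  qed (use h e in \<open>auto intro: sine_multiplierD\<close>)
  then obtain k where k: "sine_multiplier k" "\<And>x. x \<in> {0..1} \<Longrightarrow> \<bar>h x - k x\<bar> < e" by blast
  have "sinp pi 1 (\<lambda>x. 1 * sin (of_int 1 * pi * x))" by (intro sinp.basis) auto
  then have "sine_poly (\<lambda>x. sin (pi * x))" by (auto simp: sine_poly_def)
  then have "sine_poly (\<lambda>x. sin (pi * x) * k x)" by (rule sine_multiplierD(2)[OF k(1)])
  then obtain b N where "sinp b N (\<lambda>x. sin (pi * x) * k x)" by (auto simp: sine_poly_def)
  moreover have "\<bar>sin (pi * x) * k x - sin (pi * x) * h x\<bar> \<le> e" if "x \<in> {0..1}" for x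
  proof -
    have "\<bar>sin (pi * x)\<bar> * \<bar>k x - h x\<bar> \<le> 1 * e"
      using k(2)[OF that] by (intro mult_mono) auto
    then show ?thesis by (simp add: abs_mult flip: right_diff_distrib)
  qed
  ultimately show thesis by (rule that)
qed

lemma sinp_continuous: "sinp a M f \<Longrightarrow> continuous_on A f"
  by (meson DERIV_isCont continuous_at_imp_continuous_on sinp_derivs(1))

text \<open>The error has two sources: \<delta> B from the uniform approximation of the mollified
  distribution, and C \<delta> B from replacing \<phi> by its mollification. The second costs one
  derivative beyond the seminorm order, hence \<open>Suc k\<close>. The sum \<open>g\<close> is
  fixed before \<phi>, k and C, because one sequence must later serve all test functions.\<close>

lemma distribution01_sinp_approx:
  assumes U: "distribution01 U" and \<delta>: "0 < \<delta>" "\<delta> < 1 / 4"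
  obtains c M g where "sinp c M g"
    "\<And>\<phi> a b k C B. smooth_everywhere \<phi> \<Longrightarrow> supported_in \<phi> a b \<Longrightarrow> 2 * \<delta> \<le> a \<Longrightarrow> a \<le> b \<Longrightarrow> b \<le> 1 - 2 * \<delta> \<Longrightarrow>
      seminorm_bound U (a - \<delta>) (b + \<delta>) k C \<Longrightarrow> 0 \<le> C \<Longrightarrow> (\<And>j x. j \<le> Suc k \<Longrightarrow> \<bar>(deriv ^^ j) \<phi> x\<bar> \<le> B) \<Longrightarrow>
      \<bar>integral {0..1} (\<lambda>x. g x * \<phi> x) - U \<phi>\<bar> \<le> \<delta> * ((1 + C) * B)"
proof -
  obtain \<rho> where \<rho>: "smooth_everywhere \<rho>" "supported_in \<rho> (- \<delta>) \<delta>" "\<And>x. 0 \<le> \<rho> x"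
    "(\<rho> has_integral 1) {- \<delta>..\<delta>}"
    using mollifier_exists[OF \<delta>(1)] by metis
  let ?c = "\<lambda>x. max (2 * \<delta>) (min (1 - 2 * \<delta>) x)"
  have c: "?c x \<in> {2 * \<delta>..1 - 2 * \<delta>}" for x using \<delta> by auto
  define F where "F = (\<lambda>x. U (\<lambda>y. \<rho> (- 1 * y + x)))"
  \<comment> \<open>The clamped argument stays away from 0 and 1, so the denominator is positive and
    \<open>h\<close> is continuous on all of [0,1].\<close>
  define h where "h = (\<lambda>x. F (?c x) / sin (pi * ?c x))"
  have contF: "continuous_on {2 * \<delta>..1 - 2 * \<delta>} F"
    unfolding F_def by (rule distribution01_translate_continuous[OF U \<rho>(1,2) \<delta>])
  have contFc: "continuous_on {0..1} (\<lambda>x. F (?c x))"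
    by (rule continuous_on_compose2[OF contF]) (use c in \<open>auto intro!: continuous_intros\<close>)
  have sin_pos: "0 < sin (pi * ?c x)" for x
  proof (rule sin_gt_zero)
    show "0 < pi * ?c x" using c[of x] \<delta> by (intro mult_pos_pos) auto
    have "pi * ?c x < pi * 1" using c[of x] \<delta> by (intro mult_strict_left_mono) auto
    then show "pi * ?c x < pi" by simp
  qed
  have conth: "continuous_on {0..1} h"
    unfolding h_def by (intro continuous_intros contFc ballI) (use sin_pos in \<open>simp add: less_imp_neq[symmetric]\<close>)
  obtain a0 M g where g: "sinp a0 M g" "\<And>x. x \<in> {0..1} \<Longrightarrow> \<bar>g x - sin (pi * x) * h x\<bar> \<le> \<delta>"
    using sinp_uniform_approx[OF conth \<delta>(1)] by metis
  show thesis
  proof (rule that[OF g(1)])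
    fix \<phi> :: "real \<Rightarrow> real" and a b C B :: real and k :: nat
    assume \<phi>: "smooth_everywhere \<phi>" "supported_in \<phi> a b" and ab: "2 * \<delta> \<le> a" "a \<le> b" "b \<le> 1 - 2 * \<delta>"
      and C: "seminorm_bound U (a - \<delta>) (b + \<delta>) k C" "0 \<le> C"
      and B: "\<And>j x. j \<le> Suc k \<Longrightarrow> \<bar>(deriv ^^ j) \<phi> x\<bar> \<le> B"
    let ?m = "mollify \<rho> \<phi> 1"
    have B0: "\<bar>\<phi> x\<bar> \<le> B" for x using B[of 0] by simp
    have Bnn: "0 \<le> B" using B0[of 0] by linarith
    have i1: "((\<lambda>x. \<phi> x * F (?c x)) has_integral U ?m) {0..1}"
      unfolding F_def by (rule distribution01_mollify[OF U \<rho>(1,2) \<phi> ab(1,3) \<delta>])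
    have i2: "((\<lambda>x. g x * \<phi> x) has_integral integral {0..1} (\<lambda>x. g x * \<phi> x)) {0..1}"
      by (intro integrable_integral integrable_continuous_interval continuous_intros
          sinp_continuous[OF g(1)] smooth_everywhere_continuous0 \<phi>)
    have i3: "((\<lambda>x. g x * \<phi> x - \<phi> x * F (?c x)) has_integral integral {0..1} (\<lambda>x. g x * \<phi> x) - U ?m) {0..1}"
      by (rule has_integral_diff[OF i2 i1])
    have bd: "norm (g x * \<phi> x - \<phi> x * F (?c x)) \<le> \<delta> * B" if x: "x \<in> {0..1}" for x
    proof (cases "x \<in> {a..b}")
      case True
      then have "?c x = x" using ab by auto
      then have "F (?c x) = sin (pi * x) * h x"
        using sin_pos[of x] by (simp add: h_def)
      then have "norm (g x * \<phi> x - \<phi> x * F (?c x)) = \<bar>g x - sin (pi * x) * h x\<bar> * \<bar>\<phi> x\<bar>"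
        by (simp add: algebra_simps flip: abs_mult)
      also have "\<dots> \<le> \<delta> * B" using g(2)[OF x] B0 \<delta> by (intro mult_mono) auto
      finally show ?thesis .
    next
      case False
      then have "\<phi> x = 0" using \<phi>(2) by (auto simp: supported_in_def)
      then show ?thesis using Bnn \<delta> by simp
    qed
    have i4: "((\<lambda>x. \<delta> * B) has_integral \<delta> * B) {0..1::real}"
      using has_integral_const_real[of "\<delta> * B" 0 1] by simp
    have "norm (integral {0..1} (\<lambda>x. g x * \<phi> x - \<phi> x * F (?c x))) \<le> integral {0..1::real} (\<lambda>x. \<delta> * B)"
      by (rule integral_norm_bound_integral[OF has_integral_integrable[OF i3] has_integral_integrable[OF i4] bd])
    then have first: "\<bar>integral {0..1} (\<lambda>x. g x * \<phi> x) - U ?m\<bar> \<le> \<delta> * B"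
      unfolding integral_unique[OF i3] integral_unique[OF i4] by simp
    have sm: "smooth_everywhere ?m" by (intro mollify_smooth \<rho> smooth_everywhere_continuous0 \<phi>)
    have supm: "supported_in ?m (a - \<delta>) (b + \<delta>)" by (rule mollify_supported[OF \<rho>(2) \<phi>(2)])
    have sup\<phi>: "supported_in \<phi> (a - \<delta>) (b + \<delta>)" using \<phi>(2) \<delta> by (auto intro: supported_in_mono)
    let ?d = "\<lambda>x. 1 * ?m x + (- 1) * \<phi> x"
    have test: "test_fun01 f" if "smooth_everywhere f" "supported_in f (a - \<delta>) (b + \<delta>)" for f
      using test_fun01I[OF that] ab \<delta> by auto
    have "\<bar>(deriv ^^ j) ?d x\<bar> \<le> \<delta> * B" if "j \<le> k" for j x
      unfolding smooth_everywhere_lincomb(2)[OF sm \<phi>(1)]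
      using mollify_close[OF \<rho> \<phi> ab(1,3) \<delta>(1) B, of j x] that by simp
    moreover have "smooth_everywhere ?d" by (intro smooth_everywhere_lincomb sm \<phi>)
    moreover have "supported_in ?d (a - \<delta>) (b + \<delta>)" using supm sup\<phi> by (auto simp: supported_in_def)
    ultimately have "\<bar>U ?d\<bar> \<le> C * (\<delta> * B)" using C(1) unfolding seminorm_bound_def by blast
    moreover have "U ?d = 1 * U ?m + (- 1) * U \<phi>"
      by (rule distribution01_lincomb[OF U test[OF sm supm] test[OF \<phi>(1) sup\<phi>]])
    ultimately have "\<bar>U ?m - U \<phi>\<bar> \<le> C * (\<delta> * B)" by simp
    moreover have "\<delta> * ((1 + C) * B) = \<delta> * B + C * (\<delta> * B)" by (simp add: algebra_simps)
    ultimately show "\<bar>integral {0..1} (\<lambda>x. g x * \<phi> x) - U \<phi>\<bar> \<le> \<delta> * ((1 + C) * B)"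
      using first by linarith
  qed
qed

lemma distribution01_sinp_sequence:
  assumes U: "distribution01 U"
  obtains g :: "nat \<Rightarrow> real \<Rightarrow> real" where "\<And>n. sine_poly (g n)"
    "\<And>\<phi>. test_fun01 \<phi> \<Longrightarrow> (\<lambda>n. integral {0..1} (\<lambda>x. g n x * \<phi> x)) \<longlonglongrightarrow> U \<phi>"
proof -
  \<comment> \<open>The shift by 5 gives \<delta> n < 1/4 already at n = 0.\<close>
  define \<delta> where "\<delta> = (\<lambda>n. 1 / real (n + 5))"
  have \<delta>: "0 < \<delta> n" "\<delta> n < 1 / 4" for n by (auto simp: \<delta>_def field_simps)
  have lim: "\<delta> \<longlonglongrightarrow> 0" unfolding \<delta>_def
    using LIMSEQ_ignore_initial_segment[OF lim_1_over_n, of 5] by simp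
  define good where "good = (\<lambda>n g. sine_poly g \<and> (\<forall>\<phi> a b k C B. smooth_everywhere \<phi> \<longrightarrow> supported_in \<phi> a b \<longrightarrow>
      2 * \<delta> n \<le> a \<longrightarrow> a \<le> b \<longrightarrow> b \<le> 1 - 2 * \<delta> n \<longrightarrow>
      seminorm_bound U (a - \<delta> n) (b + \<delta> n) k C \<longrightarrow> 0 \<le> C \<longrightarrow> (\<forall>j x. j \<le> Suc k \<longrightarrow> \<bar>(deriv ^^ j) \<phi> x\<bar> \<le> B) \<longrightarrow>
      \<bar>integral {0..1} (\<lambda>x. g x * \<phi> x) - U \<phi>\<bar> \<le> \<delta> n * ((1 + C) * B)))"
  have "\<exists>g. good n g" for n
  proof (rule distribution01_sinp_approx[OF U \<delta>[of n]])
    fix c M g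
    assume g: "sinp c M g" and *: "\<And>\<phi> a b k C B. smooth_everywhere \<phi> \<Longrightarrow> supported_in \<phi> a b \<Longrightarrow>
      2 * \<delta> n \<le> a \<Longrightarrow> a \<le> b \<Longrightarrow> b \<le> 1 - 2 * \<delta> n \<Longrightarrow>
      seminorm_bound U (a - \<delta> n) (b + \<delta> n) k C \<Longrightarrow> 0 \<le> C \<Longrightarrow> (\<And>j x. j \<le> Suc k \<Longrightarrow> \<bar>(deriv ^^ j) \<phi> x\<bar> \<le> B) \<Longrightarrow>
      \<bar>integral {0..1} (\<lambda>x. g x * \<phi> x) - U \<phi>\<bar> \<le> \<delta> n * ((1 + C) * B)"
    show ?thesis
      unfolding good_def
    proof (intro exI[of _ g] conjI)
      show "sine_poly g" using g by (auto simp: sine_poly_def)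
    qed (intro allI impI, rule *; blast)
  qed
  then obtain g where good: "\<And>n. good n (g n)" by metis
  note g = good[unfolded good_def, THEN conjunct1]
    good[unfolded good_def, THEN conjunct2, rule_format]
  show thesis
  proof (rule that[OF g(1)])
    fix \<phi> assume "test_fun01 \<phi>"
    then obtain a b where \<phi>: "smooth_everywhere \<phi>" "supported_in \<phi> a b" and ab: "0 < a" "a \<le> b" "b < 1"
      unfolding test_fun01_def by blast
    \<comment> \<open>An interval reaching halfway to the endpoints contains the support widened by
      \<delta> n for all large n, so k and C do not depend on n.\<close>
    obtain k C where C: "0 \<le> C" "seminorm_bound U (a / 2) ((1 + b) / 2) k C"
      by (rule distribution01_seminorm_bound[OF U, of "a / 2" "(1 + b) / 2"]) (use ab in auto)
    have "\<exists>B. \<forall>x. \<bar>(deriv ^^ j) \<phi> x\<bar> \<le> B" for j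
      by (rule supported_in_bounded[OF \<phi>, of j]) blast
    then obtain D where D: "\<And>j x. \<bar>(deriv ^^ j) \<phi> x\<bar> \<le> D j" by metis
    define B where "B = (\<Sum>j\<le>Suc k. \<bar>D j\<bar>)"
    have B: "\<bar>(deriv ^^ j) \<phi> x\<bar> \<le> B" if "j \<le> Suc k" for j x
      using member_le_sum[of j "{..Suc k}" "\<lambda>j. \<bar>D j\<bar>"] D[of j x] that unfolding B_def by auto
    have "\<forall>\<^sub>F n in sequentially. \<delta> n < min (a / 2) ((1 - b) / 2)"
      using ab by (intro order_tendstoD(2)[OF lim]) auto
    then have ev: "\<forall>\<^sub>F n in sequentially. norm (integral {0..1} (\<lambda>x. g n x * \<phi> x) - U \<phi>) \<le> \<delta> n * ((1 + C) * B)"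
    proof eventually_elim
      case (elim n)
      then have n: "2 * \<delta> n \<le> a" "b \<le> 1 - 2 * \<delta> n" "a / 2 \<le> a - \<delta> n" "b + \<delta> n \<le> (1 + b) / 2"
        by (auto simp: field_simps)
      have "seminorm_bound U (a - \<delta> n) (b + \<delta> n) k C"
        using C(2) supported_in_mono[OF _ n(3,4)] unfolding seminorm_bound_def by blast
      then show ?case using g(2)[OF \<phi> n(1) ab(2) n(2)] C(1) B by simp
    qed
    have "(\<lambda>n. \<delta> n * ((1 + C) * B)) \<longlonglongrightarrow> 0"
      using tendsto_mult_left_zero[OF lim] by simp
    with ev have "(\<lambda>n. integral {0..1} (\<lambda>x. g n x * \<phi> x) - U \<phi>) \<longlonglongrightarrow> 0"
      by (rule Lim_null_comparison)
    then show "(\<lambda>n. integral {0..1} (\<lambda>x. g n x * \<phi> x)) \<longlonglongrightarrow> U \<phi>" by (rule LIM_zero_cancel)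
  qed
qed

subsection \<open>Very weak solutions\<close>

text \<open>Sine sums together with their first derivatives form a class closed under
  differentiation.\<close>

lemma sine_poly_smooth:
  assumes "sine_poly f" shows "smooth_everywhere f"
proof (rule smooth_everywhereI_closed)
  let ?S = "{f. sine_poly f} \<union> {deriv f |f. sine_poly f}"
  show "f \<in> ?S" using assms by simp
  show "\<exists>f'\<in>?S. \<forall>x. (g has_real_derivative f' x) (at x)" if g: "g \<in> ?S" for g
  proof (cases "sine_poly g")
    case True
    then obtain a M where "sinp a M g" by (auto simp: sine_poly_def)
    then show ?thesis using True sinp_derivs(1) by (intro bexI[of _ "deriv g"]) auto
  next
    case False
    then obtain f a M where f: "g = deriv f" "sinp a M f" using g by (auto simp: sine_poly_def)
    then have "sine_poly (deriv g)" using sinp_derivs(4)[OF f(2)] by (auto simp: sine_poly_def)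
    then show ?thesis using sinp_derivs(3)[OF f(2)] f(1) by (intro bexI[of _ "deriv g"]) auto
  qed
qed

section \<open>Integrals and norms on the unit interval\<close>

lemma LBINT_01_continuous:
  fixes f :: "real \<Rightarrow> real"
  assumes "continuous_on {0..1} f"
  shows "interval_lebesgue_integrable lborel 0 1 f" and "(LBINT x=0..1. f x) = integral {0..1} f"
proof -
  have "set_integrable lborel {0..1} f"
    using assms by (intro borel_integrable_atLeastAtMost') auto
  then show "(LBINT x=0..1. f x) = integral {0..1} f"
    using interval_integral_eq_integral[of 0 1 f] by (simp flip: zero_ereal_def one_ereal_def)
  show "interval_lebesgue_integrable lborel 0 1 f"
    using interval_integrable_continuous_on[of 0 1 f] assms by (simp flip: zero_ereal_def one_ereal_def)
qed

text \<open>The interval has length 1, so a sup bound is an L2 bound with the same constant.\<close>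

lemma L2_boundedI:
  fixes f :: "real \<Rightarrow> real"
  assumes f: "continuous_on UNIV f" and M: "\<And>x. \<bar>f x\<bar> \<le> M"
  shows "L2_bounded f M"
proof -
  have c: "continuous_on {0..1} (\<lambda>x. (f x)\<^sup>2)"
    by (intro continuous_intros continuous_on_subset[OF f]) auto
  have "f \<in> borel_measurable lborel"
    using borel_measurable_continuous_onI[OF f] by simp
  then have "L2_01 f"
    unfolding L2_01_def using LBINT_01_continuous(1)[OF c] by (auto intro: measurable_restrict_space1)
  moreover have "L2norm01 f \<le> M"
  proof -
    have nn: "0 \<le> M" using M[of 0] by linarith
    have "(f x)\<^sup>2 \<le> M\<^sup>2" for x using M[of x] nn by (simp add: abs_le_square_iff[symmetric])
    then have "integral {0..1} (\<lambda>x. (f x)\<^sup>2) \<le> integral {0..1::real} (\<lambda>x. M\<^sup>2)"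
      by (intro integral_le integrable_continuous_interval c) auto
    then show ?thesis
      unfolding L2norm01_def LBINT_01_continuous(2)[OF c] using nn by (intro real_le_lsqrt) auto
  qed
  ultimately show ?thesis by (simp add: L2_bounded_def)
qed

lemma sine_poly_bounds:
  assumes "sine_poly f"
  obtains B where "\<And>x. \<bar>f x\<bar> \<le> B" "\<And>x. \<bar>deriv f x\<bar> \<le> B" "\<And>x. \<bar>deriv (deriv f) x\<bar> \<le> B"
proof -
  obtain a M where f: "sinp a M f" using assms by (auto simp: sine_poly_def)
  show thesis
    by (rule that[of "max M (max (a * M) (a\<^sup>2 * M))"])
      (use sinp_values(1)[OF f] sinp_derivs(2)[OF f] sinp_values(1)[OF sinp_derivs(4)[OF f]]
        in \<open>simp_all add: le_max_iff_disj\<close>)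
qed

text \<open>One number \<open>B\<close> dominates everything that moderateness will ask about an
  approximation, so that only one sequence has to be slowed down.\<close>

definition bounded_wave :: "real \<Rightarrow> (real \<Rightarrow> real) \<Rightarrow> (real \<Rightarrow> real) \<Rightarrow> (real \<Rightarrow> real) \<Rightarrow> (real \<Rightarrow> real)
    \<Rightarrow> (real \<Rightarrow> real \<Rightarrow> real) \<Rightarrow> real \<Rightarrow> bool" where
  "bounded_wave T p \<nu> u0 u1 u B \<longleftrightarrow> solves_wave T p (deriv \<nu>) u0 u1 u
    \<and> (\<forall>x. \<forall>f\<in>{p, deriv p, \<nu>, deriv \<nu>, u0, deriv u0, deriv (deriv u0), u1}. \<bar>f x\<bar> \<le> B)
    \<and> (\<forall>t\<in>{0..T}. \<forall>f\<in>{u t, deriv (u t)}. continuous_on UNIV f \<and> (\<forall>x. \<bar>f x\<bar> \<le> B))"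

lemma bounded_wave_exists:
  assumes p: "sine_poly p" and v: "sine_poly \<nu>" and u0: "sine_poly u0" and u1: "sine_poly u1"
  shows "\<exists>u B. bounded_wave T p \<nu> u0 u1 u B"
proof -
  obtain Bp where Bp: "\<And>x. \<bar>p x\<bar> \<le> Bp" "\<And>x. \<bar>deriv p x\<bar> \<le> Bp" by (rule sine_poly_bounds[OF p]) (rule that)
  obtain Bv where Bv: "\<And>x. \<bar>\<nu> x\<bar> \<le> Bv" "\<And>x. \<bar>deriv \<nu> x\<bar> \<le> Bv" by (rule sine_poly_bounds[OF v]) (rule that)
  obtain B0 where B0: "\<And>x. \<bar>u0 x\<bar> \<le> B0" "\<And>x. \<bar>deriv u0 x\<bar> \<le> B0" "\<And>x. \<bar>deriv (deriv u0) x\<bar> \<le> B0"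
    by (rule sine_poly_bounds[OF u0]) (rule that)
  obtain B1 where B1: "\<And>x. \<bar>u1 x\<bar> \<le> B1" by (rule sine_poly_bounds[OF u1]) (rule that)
  obtain d1 P d2 V a1 M1 a2 M2 where
    s: "sinp d1 P p" "sinp d2 V \<nu>" "sinp a1 M1 u0" "sinp a2 M2 u1"
    using assms unfolding sine_poly_def by blast
  obtain u ut utt ux uxx :: "real \<Rightarrow> real \<Rightarrow> real" where w:
    "\<And>t x. ((\<lambda>s. u s x) has_real_derivative ut t x) (at t)"
    "\<And>t x. ((\<lambda>s. ut s x) has_real_derivative utt t x) (at t)"
    "\<And>t x. (u t has_real_derivative ux t x) (at x)"
    "\<And>t x. (ux t has_real_derivative uxx t x) (at x)"
    "\<And>t x. utt t x - uxx t x + p x * ux t x + deriv \<nu> x * u t x = 0"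
    "\<And>x. u 0 x = u0 x" "\<And>x. ut 0 x = u1 x"
    "\<And>t. u t 0 = 0" "\<And>t. u t 1 = 0"
    "\<And>T. \<exists>B. \<forall>t\<in>{0..T}. \<forall>x. \<bar>u t x\<bar> \<le> B \<and> \<bar>ux t x\<bar> \<le> B"
    by (rule wave_equation_sinp[OF s]) (rule that)
  obtain Bu where Bu: "\<And>t x. t \<in> {0..T} \<Longrightarrow> \<bar>u t x\<bar> \<le> Bu" "\<And>t x. t \<in> {0..T} \<Longrightarrow> \<bar>ux t x\<bar> \<le> Bu"
    using w(10)[of T] by blast
  have du: "deriv (u t) = ux t" for t by (intro ext DERIV_imp_deriv w(3))
  have cu: "continuous_on A (u t)" "continuous_on A (ux t)" for A t
    by (meson DERIV_isCont continuous_at_imp_continuous_on w(3), meson DERIV_isCont continuous_at_imp_continuous_on w(4))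
  let ?B = "max Bp (max Bv (max B0 (max B1 Bu)))"
  have "solves_wave T p (deriv \<nu>) u0 u1 u"
    unfolding solves_wave_def
  proof (intro conjI exI ballI)
    fix t x :: real
    show "((\<lambda>s. u s x) has_real_derivative ut t x) (at t within {0..T})"
      "((\<lambda>s. ut s x) has_real_derivative utt t x) (at t within {0..T})"
      by (rule has_field_derivative_at_within, rule w)+
    show "((\<lambda>y. u t y) has_real_derivative ux t x) (at x)" "((\<lambda>y. ux t y) has_real_derivative uxx t x) (at x)"
      by (rule w)+
    show "continuous_on {0..1} (\<lambda>y. u t y)" by (rule cu)
  qed (rule w)+
  then have "bounded_wave T p \<nu> u0 u1 u ?B"
    unfolding bounded_wave_def using Bp Bv B0 B1 Bu cu by (simp add: du le_max_iff_disj)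
  then show ?thesis by blast
qed

lemma bounded_wave_zero: "bounded_wave T (\<lambda>x. 0) (\<lambda>x. 0) (\<lambda>x. 0) (\<lambda>x. 0) (\<lambda>t x. 0) 0"
proof -
  have "deriv (\<lambda>x::real. 0::real) = (\<lambda>x. 0)" by (intro ext) simp
  then show ?thesis
    unfolding bounded_wave_def solves_wave_def
    by (auto intro!: exI[of _ "\<lambda>t x. 0"])
qed

text \<open>Take the largest n with n \<le> |ln \<epsilon>| and B n \<le> |ln \<epsilon>|. The first
  condition makes the set finite, \<open>B 0 = 0\<close> makes it nonempty, and every fixed k enters
  it once |ln \<epsilon>| exceeds both k and B k; monotonicity of \<open>B\<close> is never
  invoked.\<close>

lemma slow_index_exists:
  fixes B :: "nat \<Rightarrow> real"
  assumes B0: "B 0 = 0"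
  obtains N :: "real \<Rightarrow> nat" where "\<And>\<epsilon>. B (N \<epsilon>) \<le> \<bar>ln \<epsilon>\<bar>" "filterlim N sequentially (at_right 0)"
proof -
  define A where "A = (\<lambda>\<epsilon>. {n. real n \<le> \<bar>ln \<epsilon>\<bar> \<and> B n \<le> \<bar>ln \<epsilon>\<bar>})"
  define N where "N = (\<lambda>\<epsilon>. Max (A \<epsilon>))"
  have fin: "finite (A \<epsilon>)" for \<epsilon>
  proof (rule finite_subset)
    show "A \<epsilon> \<subseteq> {..nat \<lfloor>\<bar>ln \<epsilon>\<bar>\<rfloor>}" by (auto simp: A_def le_nat_floor)
  qed simp
  have "0 \<in> A \<epsilon>" for \<epsilon> using B0 by (simp add: A_def)
  then have "N \<epsilon> \<in> A \<epsilon>" for \<epsilon> unfolding N_def using fin by (intro Max_in) auto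
  then have "B (N \<epsilon>) \<le> \<bar>ln \<epsilon>\<bar>" for \<epsilon> by (simp add: A_def)
  moreover have "filterlim N sequentially (at_right 0)"
    unfolding filterlim_at_top
  proof
    fix k
    define c where "c = max (real k) (B k)"
    have "\<forall>\<^sub>F \<epsilon> in at_right 0. \<epsilon> < exp (- c)" "\<forall>\<^sub>F \<epsilon> in at_right (0::real). 0 < \<epsilon>"
      by (auto simp: eventually_at_right_field intro: exI[of _ "exp (- c)"] exI[of _ 1])
    then show "\<forall>\<^sub>F \<epsilon> in at_right 0. k \<le> N \<epsilon>"
    proof eventually_elim
      case (elim \<epsilon>)
      then have "ln \<epsilon> < - c" by (metis exp_gt_zero ln_exp ln_less_cancel_iff)
      then have "k \<in> A \<epsilon>" by (auto simp: A_def c_def)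
      then show ?case unfolding N_def using fin by (intro Max_ge)
    qed
  qed
  ultimately show thesis by (rule that)
qed

lemma abs_ln_le_inverse: "\<epsilon> \<in> {0<..1} \<Longrightarrow> \<bar>ln \<epsilon>\<bar> \<le> 1 / (\<epsilon>::real)"
  using ln_le_minus_one[of "1 / \<epsilon>"] by (simp add: ln_div)

lemma regularises_reindexed:
  assumes g: "\<And>n. sine_poly (g n)"
    and lim: "\<And>\<phi>. test_fun01 \<phi> \<Longrightarrow> (\<lambda>n. integral {0..1} (\<lambda>x. g n x * \<phi> x)) \<longlonglongrightarrow> U \<phi>"
    and N: "filterlim N sequentially (at_right 0)"
  shows "regularises (\<lambda>\<epsilon>. g (N \<epsilon>)) U"
proof -
  have "((\<lambda>\<epsilon>. LBINT x=0..1. g (N \<epsilon>) x * \<phi> x) \<longlongrightarrow> U \<phi>) (at_right 0)" if \<phi>: "test_fun01 \<phi>" for \<phi>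
  proof -
    have "smooth_everywhere \<phi>" using \<phi> by (simp add: test_fun01_def)
    then have "continuous_on {0..1} (\<lambda>x. g n x * \<phi> x)" for n
      using smooth_everywhere_continuous0[OF sine_poly_smooth[OF g]] smooth_everywhere_continuous0
      by (intro continuous_on_mult)
    then have "(LBINT x=0..1. g n x * \<phi> x) = integral {0..1} (\<lambda>x. g n x * \<phi> x)" for n
      by (rule LBINT_01_continuous)
    then show ?thesis using filterlim_compose[OF lim[OF \<phi>] N] by simp
  qed
  moreover have "smooth_on01 (g n)" for n
    using sine_poly_smooth[OF g] by (simp add: smooth_on01_def smooth_everywhere_def)
  ultimately show ?thesis by (simp add: regularises_def)
qed

lemma sine_poly_zero: "sine_poly (\<lambda>x. 0)"
  using sinp_zero[of 0 0] by (auto simp: sine_poly_def)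

text \<open>At \<epsilon> = 1 the logarithm vanishes, so the slow index can only select an
  approximation with bound 0. Index 0 is therefore reserved for the zero function; the shift does
  not affect the limit.\<close>

lemma distribution01_sequence_from_zero:
  assumes "distribution01 U"
  obtains g :: "nat \<Rightarrow> real \<Rightarrow> real" where "g 0 = (\<lambda>x. 0)" "\<And>n. sine_poly (g n)"
    "\<And>\<phi>. test_fun01 \<phi> \<Longrightarrow> (\<lambda>n. integral {0..1} (\<lambda>x. g n x * \<phi> x)) \<longlonglongrightarrow> U \<phi>"
proof -
  obtain g where g: "\<And>n. sine_poly (g n)"
    "\<And>\<phi>. test_fun01 \<phi> \<Longrightarrow> (\<lambda>n. integral {0..1} (\<lambda>x. g n x * \<phi> x)) \<longlonglongrightarrow> U \<phi>"
    by (rule distribution01_sinp_sequence[OF assms]) (rule that)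
  let ?g = "\<lambda>n. case n of 0 \<Rightarrow> (\<lambda>x. 0) | Suc m \<Rightarrow> g m"
  show thesis
  proof (rule that[of ?g])
    show "sine_poly (?g n)" for n using g(1) sine_poly_zero by (cases n) auto
    show "(\<lambda>n. integral {0..1} (\<lambda>x. ?g n x * \<phi> x)) \<longlonglongrightarrow> U \<phi>" if "test_fun01 \<phi>" for \<phi>
      by (subst filterlim_sequentially_Suc[symmetric]) (use g(2)[OF that] in simp)
  qed simp
qed

theorem theorem4p1:
  fixes T :: real and p \<nu> u0 u1 :: "(real \<Rightarrow> real) \<Rightarrow> real"
  assumes "T > 0"
    and "distribution01 p" and "distribution01 \<nu>"
    and "distribution01 u0" and "distribution01 u1"
  shows "\<exists>u. very_weak_solution T p \<nu> u0 u1 u"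
proof -
  obtain P where P: "P 0 = (\<lambda>x. 0)" "\<And>n. sine_poly (P n)"
    "\<And>\<phi>. test_fun01 \<phi> \<Longrightarrow> (\<lambda>n. integral {0..1} (\<lambda>x. P n x * \<phi> x)) \<longlonglongrightarrow> p \<phi>"
    by (rule distribution01_sequence_from_zero[OF assms(2)]) (rule that)
  obtain V where V: "V 0 = (\<lambda>x. 0)" "\<And>n. sine_poly (V n)"
    "\<And>\<phi>. test_fun01 \<phi> \<Longrightarrow> (\<lambda>n. integral {0..1} (\<lambda>x. V n x * \<phi> x)) \<longlonglongrightarrow> \<nu> \<phi>"
    by (rule distribution01_sequence_from_zero[OF assms(3)]) (rule that)
  obtain F where F: "F 0 = (\<lambda>x. 0)" "\<And>n. sine_poly (F n)"
    "\<And>\<phi>. test_fun01 \<phi> \<Longrightarrow> (\<lambda>n. integral {0..1} (\<lambda>x. F n x * \<phi> x)) \<longlonglongrightarrow> u0 \<phi>"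
    by (rule distribution01_sequence_from_zero[OF assms(4)]) (rule that)
  obtain G where G: "G 0 = (\<lambda>x. 0)" "\<And>n. sine_poly (G n)"
    "\<And>\<phi>. test_fun01 \<phi> \<Longrightarrow> (\<lambda>n. integral {0..1} (\<lambda>x. G n x * \<phi> x)) \<longlonglongrightarrow> u1 \<phi>"
    by (rule distribution01_sequence_from_zero[OF assms(5)]) (rule that)
  \<comment> \<open>The choice of \<open>u\<close> and \<open>B\<close> must return the bound 0 at
    index 0, where all four functions are zero; the implication records this.\<close>
  define W where "W = (\<lambda>n u B. bounded_wave T (P n) (V n) (F n) (G n) u B \<and> (n = 0 \<longrightarrow> B = 0))"
  have "\<exists>u B. W n u B" for n
  proof (cases "n = 0")
    case True
    then show ?thesis using bounded_wave_zero[of T] P(1) V(1) F(1) G(1) by (auto simp: W_def)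
  next
    case False
    then show ?thesis using bounded_wave_exists[OF P(2) V(2) F(2) G(2)] by (simp add: W_def)
  qed
  then obtain u B where "\<And>n. W n (u n) (B n)" by metis
  then have w: "bounded_wave T (P n) (V n) (F n) (G n) (u n) (B n)" and B0: "B 0 = 0" for n
    unfolding W_def by simp_all
  obtain N where N: "\<And>\<epsilon>. B (N \<epsilon>) \<le> \<bar>ln \<epsilon>\<bar>" "filterlim N sequentially (at_right 0)"
    by (rule slow_index_exists[of B, OF B0]) (rule that)
  have inv: "B (N \<epsilon>) \<le> 1 / \<epsilon>" if "\<epsilon> \<in> {0<..1}" for \<epsilon>
    using N(1)[of \<epsilon>] abs_ln_le_inverse[OF that] by linarith
  have data: "\<bar>f x\<bar> \<le> B n" if "f \<in> {P n, deriv (P n), V n, deriv (V n), F n, deriv (F n), deriv (deriv (F n)), G n}" for n f x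
    using w[of n] that unfolding bounded_wave_def by blast
  have sol: "continuous_on UNIV f \<and> (\<forall>x. \<bar>f x\<bar> \<le> B n)" if "t \<in> {0..T}" "f \<in> {u n t, deriv (u n t)}" for n t f
    using w[of n] that unfolding bounded_wave_def by blast
  have cont: "continuous_on UNIV f" "continuous_on UNIV (deriv f)" "continuous_on UNIV (deriv (deriv f))"
    if "sine_poly f" for f
    using smooth_everywhere_continuous[OF sine_poly_smooth[OF that], of UNIV 0]
      smooth_everywhere_continuous[OF sine_poly_smooth[OF that], of UNIV 1]
      smooth_everywhere_continuous[OF sine_poly_smooth[OF that], of UNIV 2]
    by (simp_all add: numeral_2_eq_2)
  \<comment> \<open>The chain is |f x| \<le> B (N \<epsilon>) \<le> |ln \<epsilon>| \<le> 1 /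
    \<epsilon>. The exponent 1 is written out because every moderateness condition is met with
    exponent 1 and constant 1.\<close>
  have data': "\<bar>f x\<bar> \<le> 1 / \<epsilon> ^ 1" if "\<epsilon> \<in> {0<..1}"
      "f \<in> {P (N \<epsilon>), deriv (P (N \<epsilon>)), V (N \<epsilon>), deriv (V (N \<epsilon>)), F (N \<epsilon>), deriv (F (N \<epsilon>)), deriv (deriv (F (N \<epsilon>))), G (N \<epsilon>)}"
    for f x \<epsilon>
    using order_trans[OF data[OF that(2)] inv[OF that(1)]] by simp
  have sol': "\<bar>f x\<bar> \<le> 1 / \<epsilon> ^ 1" if "\<epsilon> \<in> {0<..1}" "t \<in> {0..T}" "f \<in> {u (N \<epsilon>) t, deriv (u (N \<epsilon>) t)}"
    for f x t \<epsilon>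
    using order_trans[OF sol[OF that(2,3), THEN conjunct2, rule_format] inv[OF that(1)]] by simp
  have "log_Linf1_moderate (\<lambda>\<epsilon>. P (N \<epsilon>))"
    unfolding log_Linf1_moderate_def Linf_bounded_def
  proof (intro exI[of _ 1] conjI ballI)
    show "\<bar>P (N \<epsilon>) x\<bar> \<le> 1 * \<bar>ln \<epsilon>\<bar> ^ 1" for \<epsilon> x
      using data[of "P (N \<epsilon>)" "N \<epsilon>" x] N(1)[of \<epsilon>] by simp
  qed (simp, rule data', assumption, simp)
  moreover have "Linf1_moderate (\<lambda>\<epsilon>. V (N \<epsilon>))"
    unfolding Linf1_moderate_def Linf_bounded_def
    by (intro exI[of _ 1] conjI ballI) (simp, (rule data', assumption, simp)+)
  moreover have "H2_moderate (\<lambda>\<epsilon>. F (N \<epsilon>))"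
    unfolding H2_moderate_def
    by (intro exI[of _ 1] conjI ballI L2_boundedI cont F) (simp, (rule data', assumption, simp)+)
  moreover have "L2_moderate (\<lambda>\<epsilon>. G (N \<epsilon>))"
    unfolding L2_moderate_def
    by (intro exI[of _ 1] conjI ballI L2_boundedI cont G) (simp, (rule data', assumption, simp)+)
  moreover have "L2_moderate_t T (\<lambda>\<epsilon>. u (N \<epsilon>))"
    unfolding L2_moderate_t_def
    by (intro exI[of _ 1] conjI ballI L2_boundedI) (simp, use sol in blast, rule sol', assumption+, simp)
  moreover have "L2_moderate_t T (\<lambda>\<epsilon> t. deriv (u (N \<epsilon>) t))"
    unfolding L2_moderate_t_def
    by (intro exI[of _ 1] conjI ballI L2_boundedI) (simp, use sol in blast, rule sol', assumption+, simp)
  moreover have "solves_wave T (P (N \<epsilon>)) (deriv (V (N \<epsilon>))) (F (N \<epsilon>)) (G (N \<epsilon>)) (u (N \<epsilon>))" for \<epsilon>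
    using w[of "N \<epsilon>"] by (simp add: bounded_wave_def)
  moreover note regularises_reindexed[OF P(2,3) N(2)] regularises_reindexed[OF V(2,3) N(2)]
    regularises_reindexed[OF F(2,3) N(2)] regularises_reindexed[OF G(2,3) N(2)]
  ultimately have "very_weak_solution T p \<nu> u0 u1 (\<lambda>\<epsilon>. u (N \<epsilon>))"
    unfolding very_weak_solution_def
    by (intro exI[of _ "\<lambda>\<epsilon>. P (N \<epsilon>)"] exI[of _ "\<lambda>\<epsilon>. V (N \<epsilon>)"] exI[of _ "\<lambda>\<epsilon>. F (N \<epsilon>)"] exI[of _ "\<lambda>\<epsilon>. G (N \<epsilon>)"])
      simp
  then show ?thesis by blast
qed

end
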